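(* Let $\kappa_n$ be the support size of the almost surely unique global minimizer of $\min\{x^\top Qx:x\in\Delta^{n-1}\}$ with $Q$ drawn from the Gaussian Orthogonal Ensemble. For every fixed $k\ge3$ there exists $C_k<\infty$ such that for all $n$, $$\mathbb P(\kappa_n=k)\le C_k\,n^{2-k-2/(k+1)}(\log n)^{k-3/2+1/(k+1)}.$$ In particular, for $k=3$, there exists $C>0$ such that $$\mathbb P(\kappa_n=3)\le C\,\frac{(\log n)^{7/4}}{n^{3/2}}.$$ Consequently, there exists $C>0$ such that $$\mathbb P(\kappa_n\ge3)\le C\,\frac{(\log n)^{7/4}}{n^{3/2}}=o\left(\frac{1}{n(\log n)^{3/2}}\right).$$
   Context: $\Delta^{n-1}=\{x\in\mathbb R^n: x_i\ge 0\ \forall i,\ \sum_i x_i=1\}$. $Q$ is a random symmetric $n\times n$ matrix with $Q_{ii}\sim N(0,1)$ and $Q_{ij}=Q_{ji}\sim N(0,1/2)$ (variance $1/2$) for $i<j$, all upper-triangular entries (including the diagonal) being independent. The program has almost surely a unique global minimizer $x^\star$; $\kappa_n:=|\{i:x^\star_i>0\}|$. The $o(\cdot)$ is as $n\to\infty$. *)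

theory Defs
  imports "HOL-Probability.Probability" "HOL-Library.Landau_Symbols"
begin

text \<open>
  The dimension \<open>n\<close> varies inside the statements, so a vector of length \<open>n\<close> is a function
  \<open>nat \<Rightarrow> real\<close> with coordinates indexed by \<open>{..<n}\<close>, and an \<open>n \<times> n\<close> matrix is a function
  \<open>nat \<Rightarrow> nat \<Rightarrow> real\<close> of which only the entries with both indices below \<open>n\<close> matter. Points of the
  simplex vanish outside \<open>{..<n}\<close>, so that equality of functions is equality of vectors.
\<close>

definition std_simplex :: "nat \<Rightarrow> (nat \<Rightarrow> real) set" where
  "std_simplex n = {x. (\<forall>i<n. 0 \<le> x i) \<and> (\<Sum>i<n. x i) = 1 \<and> (\<forall>i\<ge>n. x i = 0)}"

definition quad_form :: "nat \<Rightarrow> (nat \<Rightarrow> nat \<Rightarrow> real) \<Rightarrow> (nat \<Rightarrow> real) \<Rightarrow> real" where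
  "quad_form n A x = (\<Sum>i<n. \<Sum>j<n. x i * A i j * x j)"

definition is_global_minimizer ::
    "nat \<Rightarrow> (nat \<Rightarrow> nat \<Rightarrow> real) \<Rightarrow> (nat \<Rightarrow> real) \<Rightarrow> bool" where
  "is_global_minimizer n A x \<longleftrightarrow>
     x \<in> std_simplex n \<and> (\<forall>y\<in>std_simplex n. quad_form n A x \<le> quad_form n A y)"

text \<open>
  Support size of the unique global minimizer. The value 0, which is never the support size of a
  point of the simplex, is used for those matrices whose minimizer is not unique.
\<close>

definition kappa :: "nat \<Rightarrow> (nat \<Rightarrow> nat \<Rightarrow> real) \<Rightarrow> nat" where
  "kappa n A =
     (if \<exists>!x. is_global_minimizer n A x
      then card {i. i < n \<and> 0 < (THE x. is_global_minimizer n A x) i}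
      else 0)"

text \<open>
  \<open>GOE n M Q\<close>: on the probability space \<open>M\<close>, \<open>Q\<close> is a random matrix from the Gaussian Orthogonal
  Ensemble of size \<open>n\<close>. The second parameter of \<open>normal_density\<close> is the standard deviation, so
  \<open>sqrt (1/2)\<close> stands for variance 1/2.
\<close>

definition GOE :: "nat \<Rightarrow> 'a measure \<Rightarrow> ('a \<Rightarrow> nat \<Rightarrow> nat \<Rightarrow> real) \<Rightarrow> bool" where
  "GOE n M Q \<longleftrightarrow>
     prob_space M \<and>
     (\<forall>\<omega>\<in>space M. \<forall>i<n. \<forall>j<n. Q \<omega> i j = Q \<omega> j i) \<and>
     (\<forall>i<n. distributed M lborel (\<lambda>\<omega>. Q \<omega> i i) (normal_density 0 1)) \<and>
     (\<forall>i j. i < j \<and> j < n \<longrightarrow>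
        distributed M lborel (\<lambda>\<omega>. Q \<omega> i j) (normal_density 0 (sqrt (1/2)))) \<and>
     prob_space.indep_vars M (\<lambda>_. borel) (\<lambda>(i, j) \<omega>. Q \<omega> i j) {(i, j). i \<le> j \<and> j < n}"

text \<open>The predicate is satisfiable: the canonical model on the product space.\<close>

lemma GOE_product:
  assumes n: "n \<ge> 1"
  defines "I \<equiv> {(i::nat, j). i \<le> j \<and> j < n}"
  defines "N \<equiv> \<lambda>(i::nat, j::nat). density lborel (\<lambda>x. ennreal (normal_density 0 (if i = j then 1 else sqrt (1/2)) x))"
  shows "GOE n (PiM I N) (\<lambda>\<omega> i j. \<omega> (min i j, max i j))"
proof -
  have N: "prob_space (N p)" for p
    unfolding N_def by (cases p) (auto intro!: prob_space_normal_density)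
  interpret P: prob_space "PiM I N" by (rule prob_space_PiM) (rule N)
  have sN[measurable_cong]: "sets (N p) = sets borel" for p by (cases p) (auto simp: N_def)
  have c: "distr (PiM I N) (N p) (\<lambda>\<omega>. \<omega> p) = N p" if "p \<in> I" for p
    using that N by (intro distr_PiM_component) auto
  have cb: "distr (PiM I N) borel (\<lambda>\<omega>. \<omega> p) = N p" if "p \<in> I" for p
    using c[OF that] by (metis (no_types, lifting) distr_cong sN)
  have m: "(\<lambda>\<omega>. \<omega> p) \<in> borel_measurable (PiM I N)" if "p \<in> I" for p
    using measurable_component_singleton[OF that, of N] measurable_cong_sets[OF refl sN] by blast
  have d: "distributed (PiM I N) lborel (\<lambda>\<omega>. \<omega> (i,j)) (normal_density 0 (if i = j then 1 else sqrt (1/2)))" if "(i,j) \<in> I" for i j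
  proof -
    have "distr (PiM I N) lborel (\<lambda>\<omega>. \<omega> (i,j)) = distr (PiM I N) borel (\<lambda>\<omega>. \<omega> (i,j))"
      by (intro distr_cong) auto
    then show ?thesis using cb[OF that] m[OF that] by (auto simp: distributed_def N_def)
  qed
  have "(0,0) \<in> I" using n unfolding I_def by auto
  then have ne: "I \<noteq> {}" by blast
  have "P.indep_vars (\<lambda>_. borel) (\<lambda>p \<omega>. \<omega> p) I"
  proof (subst P.indep_vars_iff_distr_eq_PiM'[OF ne])
    show "(\<lambda>\<omega>. \<omega> i) \<in> borel_measurable (PiM I N)" if "i \<in> I" for i using m that .
    have "distr (PiM I N) (\<Pi>\<^sub>M i\<in>I. borel) (\<lambda>x. \<lambda>i\<in>I. x i) = distr (PiM I N) (PiM I N) (\<lambda>x. x)"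
      by (intro distr_cong refl sets_PiM_cong) (auto simp: sN space_PiM restrict_def PiE_def extensional_def fun_eq_iff)
    also have "\<dots> = PiM I N" by (simp add: distr_id)
    also have "\<dots> = (\<Pi>\<^sub>M i\<in>I. distr (PiM I N) borel (\<lambda>\<omega>. \<omega> i))"
      by (intro PiM_cong) (auto simp: cb)
    finally show "distr (PiM I N) (\<Pi>\<^sub>M i\<in>I. borel) (\<lambda>x. \<lambda>i\<in>I. x i) = (\<Pi>\<^sub>M i\<in>I. distr (PiM I N) borel (\<lambda>\<omega>. \<omega> i))" .
  qed
  then have "P.indep_vars (\<lambda>_. borel) (\<lambda>(i, j) \<omega>. \<omega> (min i j, max i j)) I"
    by (subst P.indep_vars_cong[OF refl _ refl, where Y="\<lambda>p \<omega>. \<omega> p"]) (auto simp: I_def min_def max_def)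
  moreover have "distributed (PiM I N) lborel (\<lambda>\<omega>. \<omega> (min i i, max i i)) (normal_density 0 1)" if "i < n" for i
    using d[of i i] that by (auto simp: I_def)
  moreover have "distributed (PiM I N) lborel (\<lambda>\<omega>. \<omega> (min i j, max i j)) (normal_density 0 (sqrt (1/2)))" if "i < j" "j < n" for i j
    using d[of i j] that by (auto simp: I_def min_def max_def)
  ultimately show ?thesis
    unfolding GOE_def using P.prob_space_axioms by (auto simp: I_def min.commute max.commute)
qed

end

theory Submission
  imports Defs "HOL-Real_Asymp.Real_Asymp"
begin

text \<open>
  The minimal value \<open>l\<close> of the quadratic form is at most the smallest diagonal entry, hence about
  \<open>- sqrt (2 * ln n)\<close> or less: each diagonal entry is the value of the form at a vertex. Let \<open>x\<close> be the
  minimizer and \<open>S\<close> its support, with \<open>k\<close> elements. Stationarity says that the block of \<open>Q\<close> on \<open>S\<close> maps \<open>x\<close>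
  to the constant vector \<open>l\<close>. This linear constraint alone forces the block to be large: among symmetric
  matrices satisfying it, the one of least Frobenius norm is explicit, and its squared norm is at least
  \<open>(2 * k - 1) * l\<^sup>2\<close>, with equality when \<open>x\<close> is concentrated on one vertex
  (\<open>frob2_bound_constant_image\<close>). For the orthogonal ensemble the squared Frobenius norm of a block is a
  chi-square variable, so one given block is that large with probability about \<open>n\<close> to the power
  \<open>- (2 * k - 1)\<close>. There are at most \<open>n ^ k\<close> blocks, and a union bound gives about \<open>n powr (1 - k)\<close>. The
  threshold for \<open>l\<close> is taken slightly smaller in absolute value than the typical minimum of the diagonal, so that
  the diagonal fails to reach it with probability smaller than any power of \<open>n\<close>; this costs a small power of \<open>n\<close>,
  kept below \<open>n powr (1 / 2)\<close>, and leaves \<open>n powr (3 / 2 - k)\<close> (\<open>support_size_probability\<close>). For \<open>k \<ge> 3\<close> the claimed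
  power of \<open>n\<close> is at least this large, and the logarithmic factor is at least one for \<open>n \<ge> 3\<close>.

  The constants depend on \<open>k\<close>, so large supports have to be reduced to finitely many block sizes. For this the
  minimizer is replaced by the empirical measure \<open>y\<close> of a bounded number of independent samples drawn from the
  probability vector \<open>x\<close>. Let \<open>T\<close> consist of the sampled indices and five further indices of the support. On
  average the rows of \<open>T\<close> still send \<open>y\<close> to nearly \<open>l\<close>, so for some outcome of the sampling the rows of \<open>T\<close>
  have a total as negative as the mean (\<open>sampled_subsupport\<close>). By the Cauchy--Schwarz inequality the block on \<open>T\<close>, of size between
  \<open>5\<close> and \<open>66\<close>, then has squared norm at least about \<open>2 * k\<^sup>2 / (k + 1) * l\<^sup>2\<close> with \<open>k = card T\<close>
  (\<open>frob2_row_sum_bound\<close>). This is weaker than the sharp bound, but for \<open>k \<ge> 5\<close> it suffices for the rate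
  \<open>n powr (- 3 / 2)\<close> (\<open>large_support_probability\<close>).

  Almost sure uniqueness rests on monotonicity: raising \<open>Q i i\<close> can only lower the coordinate \<open>x i\<close> of a minimizer.
  For rational \<open>p < q\<close> and with all other entries fixed, at most one value of \<open>Q i i\<close> admits both a minimizer
  with \<open>x i \<le> p\<close> and one with \<open>x i \<ge> q\<close>, and a single value has probability zero by
  Fubini's theorem. Measurability of the support size comes from compactness of the simplex: that some minimizer lies in a
  given closed set is a countable Boolean combination of open conditions on the matrix.
\<close>

section \<open>First-order conditions at a minimizer\<close>

lemma linear_coeff_zero:
  fixes b c e :: real
  assumes "e > 0" and *: "\<And>s. \<bar>s\<bar> \<le> e \<Longrightarrow> b * s + c * s\<^sup>2 \<ge> 0"
  shows "b = 0"
proof -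
  have lim: "((\<lambda>s. b + c * s) \<longlongrightarrow> b) (at 0)"
    by (auto intro!: tendsto_eq_intros)
  have ev: "\<forall>\<^sub>F s in at_right 0. b + c * s \<ge> 0"
    unfolding eventually_at_right_field
  proof (intro exI[of _ e] conjI allI impI)
    fix s assume "0 < s" "s < e"
    then have "s * (b + c * s) \<ge> 0" using *[of s] by (simp add: algebra_simps power2_eq_square)
    then show "b + c * s \<ge> 0" using \<open>0 < s\<close> by (simp add: zero_le_mult_iff)
  qed (use assms in auto)
  have ev': "\<forall>\<^sub>F s in at_left 0. b + c * s \<le> 0"
    unfolding eventually_at_left_field
  proof (intro exI[of _ "-e"] conjI allI impI)
    fix s assume "-e < s" "s < 0"
    then have "s * (b + c * s) \<ge> 0" using *[of s] by (simp add: algebra_simps power2_eq_square)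
    then show "b + c * s \<le> 0" using \<open>s < 0\<close> by (simp add: zero_le_mult_iff)
  qed (use assms in auto)
  have "b \<ge> 0"
    by (rule tendsto_lowerbound[OF filterlim_mono[OF lim order_refl] ev]) (auto simp: at_within_le_at)
  moreover have "b \<le> 0"
    by (rule tendsto_upperbound[OF filterlim_mono[OF lim order_refl] ev']) (auto simp: at_within_le_at)
  ultimately show ?thesis by simp
qed

lemma quad_form_towards_vertex:
  assumes sym: "\<forall>i<n. \<forall>j<n. A i j = A j i" and i: "i < n"
  shows "quad_form n A (\<lambda>j. a * x j + b * (if j = i then 1 else 0)) =
     a\<^sup>2 * quad_form n A x + 2 * a * b * (\<Sum>j<n. A i j * x j) + b\<^sup>2 * A i i"
proof -
  let ?d = "\<lambda>j. if j = i then 1 else (0::real)"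
  have "quad_form n A (\<lambda>j. a * x j + b * ?d j) =
     (\<Sum>l<n. \<Sum>j<n. a\<^sup>2 * (x l * A l j * x j) + a * b * (x l * A l j * ?d j) + a * b * (?d l * A l j * x j)
        + b\<^sup>2 * (?d l * A l j * ?d j))"
    unfolding quad_form_def by (intro sum.cong refl) (simp add: algebra_simps power2_eq_square)
  also have "\<dots> = a\<^sup>2 * quad_form n A x + a * b * (\<Sum>l<n. \<Sum>j<n. x l * A l j * ?d j)
      + a * b * (\<Sum>l<n. \<Sum>j<n. ?d l * A l j * x j) + b\<^sup>2 * (\<Sum>l<n. \<Sum>j<n. ?d l * A l j * ?d j)"
    by (simp add: quad_form_def sum.distrib sum_distrib_left)
  also have "(\<Sum>l<n. \<Sum>j<n. x l * A l j * ?d j) = (\<Sum>j<n. A i j * x j)"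
    using i sym by (auto simp: if_distrib cong: if_cong intro!: sum.cong)
  also have "(\<Sum>l<n. \<Sum>j<n. ?d l * A l j * x j) = (\<Sum>j<n. A i j * x j)"
    using i by (subst sum.swap) (simp add: if_distrib[of "\<lambda>z. z * _"] cong: if_cong)
  also have "(\<Sum>l<n. \<Sum>j<n. ?d l * A l j * ?d j) = A i i"
  proof -
    have "(\<Sum>j<n. ?d l * A l j * ?d j) = (if l = i then A i i else 0)" for l
      using i by (auto simp: mult_delta_right)
    then show ?thesis using i by simp
  qed
  finally show ?thesis by (simp add: algebra_simps)
qed

text \<open>
  As \<open>x i > 0\<close>, one can move from \<open>x\<close> both towards the vertex \<open>i\<close> and a little away from it without
  leaving the simplex, so the derivative of the form in this direction vanishes.
\<close>

lemma minimizer_stationary: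
  assumes sym: "\<forall>i<n. \<forall>j<n. A i j = A j i"
    and x: "is_global_minimizer n A x" and i: "i < n" "0 < x i"
  shows "(\<Sum>j<n. A i j * x j) = quad_form n A x"
proof -
  let ?g = "\<Sum>j<n. A i j * x j" and ?l = "quad_form n A x"
  have xs: "x \<in> std_simplex n" using x by (simp add: is_global_minimizer_def)
  have xi1: "x i \<le> 1"
    using xs i sum_nonneg_leq_bound[of "{..<n}" x 1 i] by (auto simp: std_simplex_def)
  have "2 * (?g - ?l) = 0"
  proof (rule linear_coeff_zero[OF i(2)])
    fix s :: real assume s: "\<bar>s\<bar> \<le> x i"
    let ?y = "\<lambda>j. (1 - s) * x j + s * (if j = i then 1 else 0)"
    have "0 \<le> ?y j" if "j < n" for j
    proof (cases "j = i")
      case True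
      have "x i + s * (1 - x i) \<ge> 0"
      proof (cases "s \<ge> 0")
        case False
        then have "s * (1 - x i) \<ge> s * 1" using xi1 i by (intro mult_left_mono_neg) auto
        then show ?thesis using s by linarith
      qed (use xi1 i in auto)
      then show ?thesis using True by (simp add: algebra_simps)
    next
      case False
      then show ?thesis using that s xi1 xs by (auto simp: std_simplex_def)
    qed
    moreover have "(\<Sum>j<n. ?y j) = 1"
      using xs i by (simp add: sum.distrib sum_distrib_left[symmetric] std_simplex_def)
    ultimately have "?y \<in> std_simplex n" using xs i by (auto simp: std_simplex_def)
    then have "?l \<le> quad_form n A ?y" using x by (simp add: is_global_minimizer_def)
    also have "\<dots> = (1 - s)\<^sup>2 * ?l + 2 * (1 - s) * s * ?g + s\<^sup>2 * A i i"
      by (rule quad_form_towards_vertex) (use sym i in auto)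
    finally show "2 * (?g - ?l) * s + (?l - 2 * ?g + A i i) * s\<^sup>2 \<ge> 0"
      by (simp add: algebra_simps power2_eq_square)
  qed
  then show ?thesis by simp
qed

lemma minimizer_le_diagonal:
  assumes sym: "\<forall>i<n. \<forall>j<n. A i j = A j i"
    and x: "is_global_minimizer n A x" and i: "i < n"
  shows "quad_form n A x \<le> A i i"
proof -
  let ?y = "\<lambda>j. 0 * x j + 1 * (if j = i then 1 else (0::real))"
  have "?y \<in> std_simplex n" using i by (auto simp: std_simplex_def)
  then have "quad_form n A x \<le> quad_form n A ?y" using x by (simp add: is_global_minimizer_def)
  also have "\<dots> = 0\<^sup>2 * quad_form n A x + 2 * 0 * 1 * (\<Sum>j<n. A i j * x j) + 1\<^sup>2 * A i i"
    by (rule quad_form_towards_vertex) (use sym i in auto)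
  finally show ?thesis by simp
qed

lemma minimizer_support:
  assumes sym: "\<forall>i<n. \<forall>j<n. A i j = A j i"
    and x: "is_global_minimizer n A x"
  defines "S \<equiv> {i. i < n \<and> 0 < x i}"
  shows "S \<subseteq> {..<n}" "finite S" "\<And>i. i \<in> S \<Longrightarrow> 0 \<le> x i" "sum x S = 1"
    "\<And>i. i \<in> S \<Longrightarrow> (\<Sum>j\<in>S. A i j * x j) = quad_form n A x"
proof -
  show S: "S \<subseteq> {..<n}" "finite S" "\<And>i. i \<in> S \<Longrightarrow> 0 \<le> x i" by (auto simp: S_def)
  have xs: "x \<in> std_simplex n" using x by (simp add: is_global_minimizer_def)
  have out: "x i = 0" if "i \<in> {..<n} - S" for i
    using that xs by (force simp: S_def std_simplex_def)
  have "sum x S = sum x {..<n}" by (rule sum.mono_neutral_left) (use S out in auto)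
  then show "sum x S = 1" using xs by (simp add: std_simplex_def)
  fix i assume i: "i \<in> S"
  have "(\<Sum>j\<in>S. A i j * x j) = (\<Sum>j<n. A i j * x j)" by (rule sum.mono_neutral_left) (use S out in auto)
  also have "\<dots> = quad_form n A x" using minimizer_stationary[OF sym x] i by (auto simp: S_def)
  finally show "(\<Sum>j\<in>S. A i j * x j) = quad_form n A x" .
qed

section \<open>Lower bounds for the Frobenius norm of a block\<close>

text \<open>
  The squared Frobenius norm of the principal block with index set \<open>T\<close>.
\<close>

definition frob2 :: "'i set \<Rightarrow> ('i \<Rightarrow> 'i \<Rightarrow> real) \<Rightarrow> real" where
  "frob2 T A = (\<Sum>i\<in>T. \<Sum>j\<in>T. (A i j)\<^sup>2)"

text \<open>
  The matrix \<open>W\<close> in the proof is the symmetric matrix of least norm that maps \<open>x\<close> to the constant vector \<open>l\<close>.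
  It lies in the span of the matrices \<open>u i * x j + x i * u j\<close>, and the constraint on \<open>A\<close> determines
  the inner product of \<open>A\<close> with every such matrix. Hence \<open>A - W\<close> is orthogonal to \<open>W\<close> and the norm of \<open>A\<close>
  is at least that of \<open>W\<close>. With \<open>r\<close> the squared norm of \<open>x\<close> and \<open>k\<close> the number of indices, the squared norm of
  \<open>W\<close> is \<open>l\<^sup>2 * (2 * k / r - 1 / r\<^sup>2)\<close>, which is smallest at \<open>r = 1\<close>, when \<open>x\<close> is a vertex.
\<close>

lemma frob2_bound_constant_image:
  fixes A :: "'i \<Rightarrow> 'i \<Rightarrow> real"
  assumes fin: "finite S" and sym: "\<And>i j. i \<in> S \<Longrightarrow> j \<in> S \<Longrightarrow> A i j = A j i"
    and nn: "\<And>i. i \<in> S \<Longrightarrow> 0 \<le> x i" and s1: "sum x S = 1"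
    and ev: "\<And>i. i \<in> S \<Longrightarrow> (\<Sum>j\<in>S. A i j * x j) = l"
  shows "(2 * real (card S) - 1) * l\<^sup>2 \<le> frob2 S A"
proof -
  define r where "r = (\<Sum>i\<in>S. (x i)\<^sup>2)"
  define k where "k = real (card S)"
  define W where "W = (\<lambda>i j. l * ((x i + x j) / r - x i * x j / r\<^sup>2))"
  have r0: "r > 0"
  proof -
    obtain i where "i \<in> S" "x i \<noteq> 0" using s1 by (metis sum.neutral zero_neq_one)
    then show ?thesis unfolding r_def using fin by (intro sum_pos2[of _ i]) auto
  qed
  have x1: "x i \<le> 1" if "i \<in> S" for i
    using sum_nonneg_leq_bound[OF fin nn s1 that] .
  have r1: "r \<le> 1"
    unfolding r_def s1[symmetric] power2_eq_square
    by (intro sum_mono) (use nn x1 in \<open>auto intro: mult_left_le\<close>)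
  \<comment> \<open>By the Cauchy--Schwarz inequality \<open>1 / k \<le> r\<close>, so \<open>r\<close> ranges over \<open>{1 / k..1}\<close>.\<close>
  have kr: "k * r \<ge> 1"
    using sum_squared_le_sum_of_squares[of x S] fin s1 by (simp add: r_def k_def mult.commute)
  have AW: "(\<Sum>i\<in>S. \<Sum>j\<in>S. A i j * W i j) = l\<^sup>2 * (2 * k / r - 1 / r\<^sup>2)"
  proof -
    have c1: "(\<Sum>i\<in>S. \<Sum>j\<in>S. A i j * x j) = k * l" using ev by (simp add: k_def)
    have c2: "(\<Sum>i\<in>S. \<Sum>j\<in>S. A i j * x i) = k * l"
    proof -
      have "(\<Sum>i\<in>S. \<Sum>j\<in>S. A i j * x i) = (\<Sum>j\<in>S. \<Sum>i\<in>S. A j i * x i)"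
        by (subst sum.swap) (intro sum.cong refl, simp add: sym)
      then show ?thesis using c1 by simp
    qed
    have c3: "(\<Sum>i\<in>S. \<Sum>j\<in>S. A i j * (x i * x j)) = l"
    proof -
      have "(\<Sum>i\<in>S. \<Sum>j\<in>S. A i j * (x i * x j)) = (\<Sum>i\<in>S. x i * (\<Sum>j\<in>S. A i j * x j))"
        by (simp add: sum_distrib_left algebra_simps)
      also have "\<dots> = l" using ev s1 by (simp add: sum_distrib_right[symmetric])
      finally show ?thesis .
    qed
    have "(\<Sum>i\<in>S. \<Sum>j\<in>S. A i j * W i j) =
       (\<Sum>i\<in>S. \<Sum>j\<in>S. l / r * (A i j * x i) + l / r * (A i j * x j) - l / r\<^sup>2 * (A i j * (x i * x j)))"
      unfolding W_def by (intro sum.cong refl) (simp add: algebra_simps add_divide_distrib)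
    also have "\<dots> = l / r * (\<Sum>i\<in>S. \<Sum>j\<in>S. A i j * x i) + l / r * (\<Sum>i\<in>S. \<Sum>j\<in>S. A i j * x j)
         - l / r\<^sup>2 * (\<Sum>i\<in>S. \<Sum>j\<in>S. A i j * (x i * x j))"
      by (simp add: sum.distrib sum_subtractf sum_distrib_left)
    also have "\<dots> = l\<^sup>2 * (2 * k / r - 1 / r\<^sup>2)"
      unfolding c1 c2 c3 by (simp add: algebra_simps power2_eq_square)
    finally show ?thesis .
  qed
  have WW: "(\<Sum>i\<in>S. \<Sum>j\<in>S. (W i j)\<^sup>2) = l\<^sup>2 * (2 * k / r - 1 / r\<^sup>2)"
  proof -
    have expand: "(\<Sum>i\<in>S. \<Sum>j\<in>S. p * (x i)\<^sup>2 + p * (x j)\<^sup>2 + q * (x i * x j)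
        - u * ((x i)\<^sup>2 * x j) - u * (x i * (x j)\<^sup>2) + w * ((x i)\<^sup>2 * (x j)\<^sup>2))
      = p * (k * r) + p * (k * r) + q * (sum x S * sum x S) - u * (r * sum x S) - u * (sum x S * r) + w * (r * r)"
      for p q u w
      by (simp add: sum.distrib sum_subtractf sum_distrib_left[symmetric] sum_distrib_right[symmetric] r_def k_def)
    have "(\<Sum>i\<in>S. \<Sum>j\<in>S. (W i j)\<^sup>2) = l\<^sup>2 * (\<Sum>i\<in>S. \<Sum>j\<in>S.
       1 / r\<^sup>2 * (x i)\<^sup>2 + 1 / r\<^sup>2 * (x j)\<^sup>2 + 2 / r\<^sup>2 * (x i * x j)
        - 2 / r^3 * ((x i)\<^sup>2 * x j) - 2 / r^3 * (x i * (x j)\<^sup>2) + 1 / r^4 * ((x i)\<^sup>2 * (x j)\<^sup>2))"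
      unfolding W_def sum_distrib_left using r0
      by (intro sum.cong refl) (simp add: field_simps power2_eq_square power3_eq_cube power4_eq_xxxx)
    also have "\<dots> = l\<^sup>2 * (2 * k / r - 1 / r\<^sup>2)"
      unfolding expand s1 using r0 by (simp add: field_simps power2_eq_square power3_eq_cube power4_eq_xxxx)
    finally show ?thesis .
  qed
  have "0 \<le> (\<Sum>i\<in>S. \<Sum>j\<in>S. (A i j - W i j)\<^sup>2)" by (intro sum_nonneg) auto
  also have "\<dots> = frob2 S A - 2 * (\<Sum>i\<in>S. \<Sum>j\<in>S. A i j * W i j) + (\<Sum>i\<in>S. \<Sum>j\<in>S. (W i j)\<^sup>2)"
    by (simp add: frob2_def power2_diff sum.distrib sum_subtractf sum_distrib_left mult.assoc)
  finally have "l\<^sup>2 * (2 * k / r - 1 / r\<^sup>2) \<le> frob2 S A" unfolding AW WW by linarith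
  moreover have "2 * k - 1 \<le> 2 * k / r - 1 / r\<^sup>2"
  proof -
    \<comment> \<open>The difference of the two sides, multiplied by \<open>r\<^sup>2\<close>, factors.\<close>
    have "0 \<le> (1 - r) * (2 * k * r - r - 1)"
      using r1 kr by (intro mult_nonneg_nonneg) linarith+
    then have "(2 * k - 1) * r\<^sup>2 \<le> 2 * k * r - 1" by (simp add: algebra_simps power2_eq_square)
    then have "2 * k - 1 \<le> (2 * k * r - 1) / r\<^sup>2" using r0 by (simp add: field_simps)
    then show ?thesis using r0 by (simp add: diff_divide_distrib power2_eq_square)
  qed
  then have "l\<^sup>2 * (2 * k - 1) \<le> l\<^sup>2 * (2 * k / r - 1 / r\<^sup>2)" by (intro mult_left_mono) auto
  ultimately show ?thesis unfolding k_def by (simp add: mult.commute)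
qed

text \<open>
  Here only the sum of all entries of \<open>A y\<close> is controlled. It is the inner product of \<open>A\<close> with the symmetric matrix
  \<open>(y i + y j) / 2\<close>, whose squared norm is at most \<open>(card T + 1) / 2\<close>.
\<close>

lemma frob2_row_sum_bound:
  fixes A :: "'i \<Rightarrow> 'i \<Rightarrow> real"
  assumes fin: "finite T" and sym: "\<And>i j. i \<in> T \<Longrightarrow> j \<in> T \<Longrightarrow> A i j = A j i"
    and nn: "\<And>i. i \<in> T \<Longrightarrow> 0 \<le> y i" and s1: "sum y T = 1"
    and m: "0 \<le> m" "(\<Sum>i\<in>T. \<Sum>j\<in>T. A i j * y j) \<le> - real (card T) * m"
  shows "2 * (real (card T))\<^sup>2 / (real (card T) + 1) * m\<^sup>2 \<le> frob2 T A"
proof -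
  define k where "k = real (card T)"
  define r where "r = (\<Sum>i\<in>T. (y i)\<^sup>2)"
  have y1: "y i \<le> 1" if "i \<in> T" for i
    using sum_nonneg_leq_bound[OF fin nn s1 that] .
  have r1: "r \<le> 1"
    unfolding r_def s1[symmetric] power2_eq_square
    by (intro sum_mono) (use nn y1 in \<open>auto intro: mult_left_le\<close>)
  let ?s = "\<Sum>i\<in>T. \<Sum>j\<in>T. A i j * y j"
  have k0: "k \<ge> 0" by (simp add: k_def)
  have c2: "(\<Sum>i\<in>T. \<Sum>j\<in>T. A i j * y i) = ?s"
    by (subst sum.swap) (intro sum.cong refl, simp add: sym)
  have WW: "(\<Sum>i\<in>T. \<Sum>j\<in>T. (y i + y j)\<^sup>2) = 2 * k * r + 2"
  proof -
    have "(\<Sum>i\<in>T. \<Sum>j\<in>T. (y i + y j)\<^sup>2) = (\<Sum>i\<in>T. \<Sum>j\<in>T. (y i)\<^sup>2 + (y j)\<^sup>2 + 2 * (y i * y j))"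
      by (simp add: power2_sum mult.assoc)
    also have "\<dots> = 2 * k * r + 2 * (sum y T * sum y T)"
      by (simp add: sum.distrib sum_distrib_left[symmetric] sum_distrib_right[symmetric] r_def k_def)
    finally show ?thesis using s1 by simp
  qed
  have "(2 * k * m)\<^sup>2 \<le> (2 * ?s)\<^sup>2"
    using m k0 by (intro abs_le_square_iff[THEN iffD1]) (auto simp: k_def)
  also have "2 * ?s = (\<Sum>i\<in>T. \<Sum>j\<in>T. A i j * (y i + y j))"
    using c2 by (simp add: distrib_left sum.distrib)
  also have "\<dots> = (\<Sum>(i,j)\<in>T \<times> T. A i j * (y i + y j))" by (simp add: sum.cartesian_product)
  also have "(\<dots>)\<^sup>2 \<le> (\<Sum>(i,j)\<in>T \<times> T. (A i j)\<^sup>2) * (\<Sum>(i,j)\<in>T \<times> T. (y i + y j)\<^sup>2)"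
    using Cauchy_Schwarz_ineq_sum[of "\<lambda>p. A (fst p) (snd p)" "\<lambda>p. y (fst p) + y (snd p)" "T \<times> T"]
    by (simp add: case_prod_unfold)
  also have "\<dots> = frob2 T A * (2 * k * r + 2)"
    unfolding frob2_def WW[symmetric] by (simp add: sum.cartesian_product)
  also have "\<dots> \<le> frob2 T A * (2 * k + 2)"
    using r1 k0 by (intro mult_left_mono) (auto simp: frob2_def intro!: sum_nonneg mult_left_le)
  finally have "2 * k\<^sup>2 * m\<^sup>2 \<le> frob2 T A * (k + 1)" by (simp add: power_mult_distrib algebra_simps)
  then have "2 * k\<^sup>2 * m\<^sup>2 / (k + 1) \<le> frob2 T A" using k0 by (simp add: field_simps)
  then show ?thesis by (simp add: k_def)
qed

section \<open>Sparsifying a large support by sampling\<close>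

text \<open>
  The expectation of \<open>f J\<close> when \<open>J 0, \<dots>, J (L - 1)\<close> are independent with distribution \<open>x\<close> on \<open>S\<close>. As a finite
  sum it turns independence into the distributive law for products of sums.
\<close>

definition iid_mean :: "nat \<Rightarrow> 'i set \<Rightarrow> ('i \<Rightarrow> real) \<Rightarrow> ((nat \<Rightarrow> 'i) \<Rightarrow> real) \<Rightarrow> real" where
  "iid_mean L S x f = (\<Sum>J\<in>PiE {..<L} (\<lambda>_. S). (\<Prod>b<L. x (J b)) * f J)"

lemma iid_mean_prod:
  assumes "finite S"
  shows "iid_mean L S x (\<lambda>J. \<Prod>b<L. h b (J b)) = (\<Prod>b<L. \<Sum>j\<in>S. x j * h b j)"
  unfolding iid_mean_def using assms by (subst prod_sum_PiE) (auto simp: prod.distrib)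

lemma iid_mean_add: "iid_mean L S x (\<lambda>J. f J + g J) = iid_mean L S x f + iid_mean L S x g"
  by (simp add: iid_mean_def distrib_left sum.distrib)

lemma iid_mean_cmult: "iid_mean L S x (\<lambda>J. c * f J) = c * iid_mean L S x f"
  by (simp add: iid_mean_def sum_distrib_left mult.left_commute)

lemma iid_mean_sum: "iid_mean L S x (\<lambda>J. \<Sum>i\<in>I. f i J) = (\<Sum>i\<in>I. iid_mean L S x (f i))"
  unfolding iid_mean_def sum_distrib_left by (rule sum.swap)

lemma iid_mean_1:
  assumes "finite S" "sum x S = 1"
  shows "iid_mean L S x (\<lambda>_. 1) = 1"
  using iid_mean_prod[of S L x "\<lambda>_ _. 1"] assms by simp

lemma iid_mean_component:
  assumes "finite S" "sum x S = 1" "b < L"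
  shows "iid_mean L S x (\<lambda>J. f (J b)) = (\<Sum>j\<in>S. x j * f j)"
proof -
  have "iid_mean L S x (\<lambda>J. f (J b)) = iid_mean L S x (\<lambda>J. \<Prod>c<L. if c = b then f (J c) else 1)"
    using assms(3) by (intro arg_cong[where f = "iid_mean L S x"] ext) (simp add: prod.delta)
  also have "\<dots> = (\<Prod>c<L. \<Sum>j\<in>S. x j * (if c = b then f j else 1))"
    by (rule iid_mean_prod) fact
  also have "\<dots> = (\<Prod>c<L. if c = b then (\<Sum>j\<in>S. x j * f j) else 1)"
    using assms(2) by (intro prod.cong) auto
  finally show ?thesis using assms(3) by simp
qed

text \<open>
  The event that \<open>i\<close> is never sampled, and the value of \<open>f\<close> at the sample \<open>J b\<close> on this event, are products over the
  samples: each of the \<open>L - 1\<close> other samples avoids \<open>i\<close> with probability \<open>1 - x i\<close>, and \<open>J b\<close> contributes the mean of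
  \<open>f\<close> without its term at \<open>i\<close>.
\<close>

lemma iid_mean_avoiding:
  assumes fin: "finite S" and s1: "sum x S = 1" and b: "b < L" and i: "i \<in> S"
  shows "iid_mean L S x (\<lambda>J. if i \<in> J ` {..<L} then 0 else f (J b)) =
           (1 - x i) ^ (L - 1) * ((\<Sum>j\<in>S. x j * f j) - x i * f i)"
proof -
  let ?h = "\<lambda>c j. (if j = i then 0 else if c = b then f j else 1)"
  have *: "(if i \<in> J ` {..<L} then 0 else f (J b)) = (\<Prod>c<L. ?h c (J c))" for J
  proof (cases "i \<in> J ` {..<L}")
    case True
    then show ?thesis by (auto intro!: prod_zero[symmetric])
  next
    case False
    then have "(\<Prod>c<L. ?h c (J c)) = (\<Prod>c<L. if c = b then f (J c) else 1)"
    proof (intro prod.cong refl)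
      fix c assume "c \<in> {..<L}"
      then have "J c \<noteq> i" using False by blast
      then show "?h c (J c) = (if c = b then f (J c) else 1)" by simp
    qed
    then show ?thesis using False b by simp
  qed
  have rem: "(\<Sum>j\<in>S. x j * (if j = i then 0 else g j)) = (\<Sum>j\<in>S. x j * g j) - x i * g i" for g
    using fin i by (simp add: sum.remove[of S i])
  have "iid_mean L S x (\<lambda>J. if i \<in> J ` {..<L} then 0 else f (J b)) = (\<Prod>c<L. \<Sum>j\<in>S. x j * ?h c j)"
    unfolding * by (rule iid_mean_prod) fact
  also have "\<dots> = (\<Prod>c<L. if c = b then (\<Sum>j\<in>S. x j * f j) - x i * f i else 1 - x i)"
    using s1 by (intro prod.cong) (auto simp: rem)
  also have "\<dots> = ((\<Sum>j\<in>S. x j * f j) - x i * f i) * (\<Prod>c\<in>{..<L} - {b}. 1 - x i)"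
    using b by (subst prod.remove[of _ b]) (auto intro!: prod.cong)
  also have "\<dots> = (1 - x i) ^ (L - 1) * ((\<Sum>j\<in>S. x j * f j) - x i * f i)"
    using b by simp
  finally show ?thesis .
qed

lemma iid_mean_nonneg_witness:
  assumes fin: "finite S" and nn: "\<And>i. i \<in> S \<Longrightarrow> 0 \<le> x i" and s1: "sum x S = 1"
    and m: "iid_mean L S x f \<ge> 0"
  obtains (witness) J where "J \<in> PiE {..<L} (\<lambda>_. S)" "f J \<ge> 0"
proof (rule ccontr)
  let ?P = "PiE {..<L} (\<lambda>_. S)" and ?w = "\<lambda>J. \<Prod>b<L. x (J b)"
  assume "\<not> thesis"
  then have neg: "f J < 0" if "J \<in> ?P" for J using that witness[of J] by force
  have finP: "finite ?P" using fin by (intro finite_PiE) auto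
  have w: "?w J \<ge> 0" if "J \<in> ?P" for J using that nn by (intro prod_nonneg) (auto simp: PiE_iff)
  have "iid_mean L S x f \<le> 0" unfolding iid_mean_def
    by (intro sum_nonpos mult_nonneg_nonpos w less_imp_le neg)
  with m have "(\<Sum>J\<in>?P. - (?w J * f J)) = 0" by (simp add: iid_mean_def sum_negf)
  then have "\<forall>J\<in>?P. - (?w J * f J) = 0"
    using finP w neg by (subst (asm) sum_nonneg_eq_0_iff) (auto simp: mult_le_0_iff less_imp_le)
  then have "\<forall>J\<in>?P. ?w J = 0" using neg by (metis less_irrefl mult_eq_0_iff neg_equal_0_iff_equal)
  then have "iid_mean L S x (\<lambda>_. 1) = 0"
    unfolding iid_mean_def mult_1_right by (intro sum.neutral)
  then show False using iid_mean_1[OF fin s1, of L] by simp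
qed

lemma one_sub_power_bound:
  fixes x :: real assumes "0 \<le> x" "x \<le> 1"
  shows "(1 - x) ^ m * (1 + real m * x) \<le> 1"
proof -
  have "(1 - x) ^ m * (1 + real m * x) \<le> (1 - x) ^ m * (1 + x) ^ m"
    using assms by (intro mult_left_mono Bernoulli_inequality) auto
  also have "\<dots> = (1 - x\<^sup>2) ^ m"
    by (simp add: power_mult_distrib[symmetric] algebra_simps power2_eq_square)
  also have "\<dots> \<le> 1" using assms by (intro power_le_one) (auto simp: power_le_one)
  finally show ?thesis .
qed

text \<open>
  Sample \<open>L\<close> indices from \<open>x\<close>, let \<open>y\<close> be their empirical measure, and let \<open>T\<close> be the union of \<open>R\<close> with the set of
  sampled indices. The claim holds for some outcome because each row \<open>i\<close> contributes a nonnegative amount on average to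
  \<open>\<Sum>i\<in>T. ((A y) i - (1 - d) * m)\<close>. For \<open>i \<in> R\<close> this is unbiasedness of \<open>y\<close>. For other \<open>i\<close> the
  row counts only if \<open>i\<close> is sampled, which biases \<open>y\<close> towards \<open>i\<close> and brings in the diagonal entry \<open>A i i\<close>.
  The gain \<open>d * m\<close>, weighted with the probability that \<open>L - 1\<close> draws hit \<open>i\<close>, outweighs this bias as soon as
  \<open>d * (L - 1) \<ge> 3\<close>.
\<close>

lemma sampled_subsupport:
  fixes A :: "'i \<Rightarrow> 'i \<Rightarrow> real"
  assumes fin: "finite S" and R: "R \<subseteq> S"
    and nn: "\<And>i. i \<in> S \<Longrightarrow> 0 \<le> x i" and s1: "sum x S = 1"
    and ev: "\<And>i. i \<in> S \<Longrightarrow> (\<Sum>j\<in>S. A i j * x j) = m" and m: "0 \<le> m"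
    and diag: "\<And>i. i \<in> S \<Longrightarrow> - 2 * m \<le> A i i"
    and d: "0 \<le> d" "3 \<le> d * (real L - 1)"
  obtains T y where "R \<subseteq> T" "T \<subseteq> S" "card T \<le> card R + L" "\<And>i. i \<in> T \<Longrightarrow> 0 \<le> y i" "sum y T = 1"
    "(1 - d) * real (card T) * m \<le> (\<Sum>i\<in>T. \<Sum>j\<in>T. A i j * y j)"
proof -
  let ?E = "iid_mean L S x"
  \<comment> \<open>The row \<open>i\<close> of \<open>A y\<close>, and its contribution to the sum.\<close>
  define h where "h = (\<lambda>J i. (\<Sum>b<L. A i (J b)) / real L)"
  define phi where "phi = (\<lambda>J i. if i \<in> R \<union> J ` {..<L} then h J i - (1 - d) * m else 0)"
  have L: "L > 0"
  proof (rule ccontr)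
    assume "\<not> L > 0" then show False using d by simp
  qed
  have x1: "x i \<le> 1" if "i \<in> S" for i
    using sum_nonneg_leq_bound[OF fin nn s1 that] .
  have Eh: "?E (\<lambda>J. h J i) = m" if "i \<in> S" for i
  proof -
    have "?E (\<lambda>J. h J i) = ?E (\<lambda>J. 1 / real L * (\<Sum>b<L. A i (J b)))" by (simp add: h_def)
    also have "\<dots> = 1 / real L * (\<Sum>b<L. \<Sum>j\<in>S. x j * A i j)"
      unfolding iid_mean_cmult iid_mean_sum
      by (intro arg_cong2[where f = "(*)"] refl sum.cong iid_mean_component) (use fin s1 in auto)
    also have "\<dots> = m" using ev[OF that] L by (simp add: mult.commute)
    finally show ?thesis .
  qed
  have pos: "?E (\<lambda>J. phi J i) \<ge> 0" if i: "i \<in> S" for i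
  proof (cases "i \<in> R")
    case True
    have "?E (\<lambda>J. phi J i) = ?E (\<lambda>J. h J i + (- ((1 - d) * m)) * 1)" using True by (simp add: phi_def)
    also have "\<dots> = d * m"
      unfolding iid_mean_add iid_mean_cmult using Eh[OF i] iid_mean_1[OF fin s1, of L] by (simp add: algebra_simps)
    finally show ?thesis using d m by simp
  next
    case False
    \<comment> \<open>The probability that \<open>L - 1\<close> samples all avoid \<open>i\<close>.\<close>
    define g where "g = (1 - x i) ^ (L - 1)"
    \<comment> \<open>Restriction to the event that \<open>i\<close> is not sampled.\<close>
    let ?av = "\<lambda>f J. if i \<in> J ` {..<L} then 0 else f J :: real"
    have av1: "?E (?av (\<lambda>_. 1)) = g * (1 - x i)"
      using iid_mean_avoiding[OF fin s1 L i, of "\<lambda>_. 1"] s1 by (simp add: g_def)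
    have avh: "?E (?av (\<lambda>J. h J i)) = g * (m - x i * A i i)"
    proof -
      have "?E (?av (\<lambda>J. h J i)) = ?E (\<lambda>J. 1 / real L * (\<Sum>b<L. ?av (\<lambda>J. A i (J b)) J))"
        by (intro arg_cong[where f = ?E] ext) (simp add: h_def)
      also have "\<dots> = 1 / real L * (\<Sum>b<L. g * ((\<Sum>j\<in>S. x j * A i j) - x i * A i i))"
        unfolding iid_mean_cmult iid_mean_sum g_def
        by (intro arg_cong2[where f = "(*)"] refl sum.cong iid_mean_avoiding) (use fin s1 i in auto)
      also have "\<dots> = g * (m - x i * A i i)" using ev[OF i] L by (simp add: mult.commute)
      finally show ?thesis .
    qed
    have "?E (\<lambda>J. phi J i) = ?E (\<lambda>J. h J i + (- 1) * ?av (\<lambda>J. h J i) J + (- ((1 - d) * m)) * 1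
        + ((1 - d) * m) * ?av (\<lambda>_. 1) J)"
      using False by (intro arg_cong[where f = ?E] ext) (auto simp: phi_def)
    also have "\<dots> = m - g * (m - x i * A i i) - (1 - d) * m + (1 - d) * m * (g * (1 - x i))"
      unfolding iid_mean_add iid_mean_cmult avh av1 Eh[OF i] iid_mean_1[OF fin s1, of L] by simp
    also have "\<dots> = d * m * (1 - g) + g * x i * (A i i - (1 - d) * m)"
      by (simp add: algebra_simps)
    also have "\<dots> \<ge> d * m * (g * (real (L - 1) * x i)) + g * x i * (- 3 * m)"
    proof (intro add_mono mult_left_mono)
      show "g * (real (L - 1) * x i) \<le> 1 - g"
        using one_sub_power_bound[OF nn[OF i] x1[OF i], of "L - 1"] by (simp add: g_def algebra_simps)
      have "d * m \<ge> 0" using d m by simp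
      then show "- 3 * m \<le> A i i - (1 - d) * m" using diag[OF i] by (simp add: algebra_simps)
    qed (use d m nn[OF i] x1[OF i] in \<open>auto simp: g_def\<close>)
    moreover have "d * m * (g * (real (L - 1) * x i)) + g * x i * (- 3 * m)
        = m * (g * x i) * (d * (real L - 1) - 3)"
      using L by (simp add: algebra_simps of_nat_diff)
    moreover have "\<dots> \<ge> 0" using d m nn[OF i] x1[OF i] by (auto simp: g_def)
    ultimately show ?thesis by linarith
  qed
  have "?E (\<lambda>J. \<Sum>i\<in>S. phi J i) \<ge> 0" unfolding iid_mean_sum by (intro sum_nonneg pos)
  then obtain J where J: "J \<in> PiE {..<L} (\<lambda>_. S)" and phi: "(\<Sum>i\<in>S. phi J i) \<ge> 0"
    using iid_mean_nonneg_witness[OF fin nn s1] by blast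
  define T where "T = R \<union> J ` {..<L}"
  \<comment> \<open>The empirical measure of the sample.\<close>
  define y where "y = (\<lambda>j. real (card {b\<in>{..<L}. J b = j}) / real L)"
  have T: "T \<subseteq> S" using R J by (auto simp: T_def PiE_iff)
  have finT: "finite T" using T fin by (rule finite_subset)
  have yf: "(\<Sum>j\<in>T. f j * y j) = (\<Sum>b<L. f (J b)) / real L" for f
  proof -
    have "(\<Sum>b<L. f (J b)) = (\<Sum>j\<in>T. \<Sum>b\<in>{b\<in>{..<L}. J b = j}. f (J b))"
      by (rule sum.group[symmetric]) (use finT in \<open>auto simp: T_def\<close>)
    also have "\<dots> = (\<Sum>j\<in>T. real L * (f j * y j))" using L by (intro sum.cong) (auto simp: y_def)
    finally show ?thesis using L by (simp add: sum_distrib_left[symmetric])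
  qed
  show thesis
  proof (rule that)
    show "R \<subseteq> T" by (simp add: T_def)
    show "T \<subseteq> S" by fact
    show "card T \<le> card R + L"
      unfolding T_def by (rule order_trans[OF card_Un_le]) (use card_image_le[of "{..<L}" J] in simp)
    show "sum y T = 1" using yf[of "\<lambda>_. 1"] L by simp
    have "(\<Sum>i\<in>S. phi J i) = (\<Sum>i\<in>T. h J i - (1 - d) * m)"
      unfolding phi_def T_def[symmetric] using fin T by (subst sum.inter_restrict[symmetric]) (auto simp: Int_absorb1)
    then show "(1 - d) * real (card T) * m \<le> (\<Sum>i\<in>T. \<Sum>j\<in>T. A i j * y j)"
      using phi unfolding yf by (simp add: h_def sum_subtractf mult.commute mult.left_commute)
  qed (auto simp: y_def)
qed

section \<open>A minimizer yields a heavy block\<close>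

definition heavy_block :: "nat \<Rightarrow> nat \<Rightarrow> real \<Rightarrow> (nat \<Rightarrow> nat \<Rightarrow> real) \<Rightarrow> bool" where
  "heavy_block n k u A \<longleftrightarrow> (\<exists>T\<subseteq>{..<n}. card T = k \<and> u \<le> frob2 T A)"

lemma support_is_heavy_block:
  assumes sym: "\<forall>i<n. \<forall>j<n. A i j = A j i"
    and x: "is_global_minimizer n A x" and k: "card {i. i < n \<and> 0 < x i} = k"
    and v: "0 \<le> v" "i < n" "A i i \<le> - v"
  shows "heavy_block n k ((2 * real k - 1) * v\<^sup>2) A"
proof -
  let ?S = "{i. i < n \<and> 0 < x i}"
  note S = minimizer_support[OF sym x]
  have "?S \<noteq> {}" using S(4) by (metis sum.empty zero_neq_one)
  then have k1: "k \<ge> 1" using k S(2) by (metis card_0_eq less_one not_le)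
  have "quad_form n A x \<le> - v" using minimizer_le_diagonal[OF sym x v(2)] v(3) by simp
  then have "v\<^sup>2 \<le> (quad_form n A x)\<^sup>2" using v(1) by (intro abs_le_square_iff[THEN iffD1]) auto
  then have "(2 * real k - 1) * v\<^sup>2 \<le> (2 * real k - 1) * (quad_form n A x)\<^sup>2"
    using k1 by (intro mult_left_mono) auto
  also have "\<dots> \<le> frob2 ?S A"
    unfolding k[symmetric] by (rule frob2_bound_constant_image[OF S(2) _ S(3) S(4) S(5)]) (use sym in auto)
  finally show ?thesis using S(1) k unfolding heavy_block_def by blast
qed

text \<open>
  The first alternative is a diagonal entry of absolute value at least \<open>2 * v\<close>. Without one, the diagonal of \<open>- Q\<close> is
  bounded below as \<open>sampled_subsupport\<close> requires. Sampling with accuracy \<open>1 / 20\<close> needs \<open>61\<close> samples, as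
  \<open>(61 - 1) / 20 = 3\<close>, and five indices of the support are put in by hand; this gives sizes from \<open>5\<close>
  to \<open>5 + 61 = 66\<close>.
\<close>

lemma large_support_heavy_block:
  assumes sym: "\<forall>i<n. \<forall>j<n. A i j = A j i"
    and x: "is_global_minimizer n A x" and k: "card {i. i < n \<and> 0 < x i} \<ge> 5"
    and v: "0 \<le> v" "i < n" "A i i \<le> - v"
  shows "heavy_block n 1 (4 * v\<^sup>2) A \<or>
    (\<exists>k\<in>{5..66}. heavy_block n k (2 * (real k)\<^sup>2 / (real k + 1) * (19 / 20)\<^sup>2 * v\<^sup>2) A)"
proof (cases "\<exists>i<n. 2 * v \<le> \<bar>A i i\<bar>")
  case True
  then obtain i where i: "i < n" "2 * v \<le> \<bar>A i i\<bar>" by blast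
  have "(2 * v)\<^sup>2 \<le> (A i i)\<^sup>2" using i v(1) by (intro abs_le_square_iff[THEN iffD1]) auto
  then have "heavy_block n 1 (4 * v\<^sup>2) A"
    using i unfolding heavy_block_def by (intro exI[of _ "{i}"]) (auto simp: frob2_def power_mult_distrib)
  then show ?thesis ..
next
  case False
  let ?S = "{i. i < n \<and> 0 < x i}"
  note S = minimizer_support[OF sym x]
  define m where "m = - quad_form n A x"
  have m: "v \<le> m" using minimizer_le_diagonal[OF sym x v(2)] v(3) by (simp add: m_def)
  obtain R where R: "R \<subseteq> ?S" "card R = 5" "finite R"
    using obtain_subset_with_card_n[OF k] by metis
  obtain T y where T: "R \<subseteq> T" "T \<subseteq> ?S" "card T \<le> card R + 61" "\<And>i. i \<in> T \<Longrightarrow> 0 \<le> y i" "sum y T = 1"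
    "(1 - 1 / 20) * real (card T) * m \<le> (\<Sum>i\<in>T. \<Sum>j\<in>T. - A i j * y j)"
  proof (rule sampled_subsupport[OF S(2) R(1) S(3) S(4), of "\<lambda>i j. - A i j" m "1 / 20" 61])
    show "(\<Sum>j\<in>?S. - A i j * x j) = m" if "i \<in> ?S" for i
      using S(5)[OF that] by (simp add: m_def sum_negf)
    show "- 2 * m \<le> - A i i" if "i \<in> ?S" for i
      using that False m by (force simp: not_le abs_if split: if_splits)
  qed (use m v in auto)
  have finT: "finite T" using T(2) S(2) by (rule finite_subset)
  have card: "5 \<le> card T" "card T \<le> 66"
    using card_mono[OF finT T(1)] R(2) T(3) by auto
  have "2 * (real (card T))\<^sup>2 / (real (card T) + 1) * (19 / 20 * v)\<^sup>2
      \<le> 2 * (real (card T))\<^sup>2 / (real (card T) + 1) * (19 / 20 * m)\<^sup>2"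
    using m v by (intro mult_left_mono power_mono) auto
  also have "\<dots> \<le> frob2 T A"
  proof (rule frob2_row_sum_bound[OF finT _ T(4) T(5)])
    show "A i j = A j i" if "i \<in> T" "j \<in> T" for i j using that T(2) sym by auto
    show "(\<Sum>i\<in>T. \<Sum>j\<in>T. A i j * y j) \<le> - real (card T) * (19 / 20 * m)"
      using T(6) by (simp add: sum_negf)
  qed (use m v in auto)
  finally have "2 * (real (card T))\<^sup>2 / (real (card T) + 1) * (19 / 20)\<^sup>2 * v\<^sup>2 \<le> frob2 T A"
    unfolding power_mult_distrib mult.assoc .
  then have "heavy_block n (card T) (2 * (real (card T))\<^sup>2 / (real (card T) + 1) * (19 / 20)\<^sup>2 * v\<^sup>2) A"
    using T(2) S(1) unfolding heavy_block_def by blast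
  then show ?thesis using card by auto
qed

section \<open>Existence of minimizers and measurability of the support size\<close>

lemma compact_std_simplex: "compact (std_simplex n)"
proof -
  let ?B = "PiE UNIV (\<lambda>i. if i < n then {0..1} else {0::real})"
  have "compactin (product_topology (\<lambda>i. euclidean) UNIV) ?B"
    by (auto simp: compactin_PiE)
  then have "compact ?B" by (simp add: euclidean_product_topology)
  moreover have "closed {x::nat \<Rightarrow> real. (\<Sum>i<n. x i) = 1}"
    by (intro closed_Collect_eq continuous_intros continuous_on_product_coordinates)
  ultimately have "compact (?B \<inter> {x. (\<Sum>i<n. x i) = 1})" by (rule compact_Int_closed)
  also have "?B \<inter> {x. (\<Sum>i<n. x i) = 1} = std_simplex n"
  proof (intro equalityI subsetI)
    fix x assume x: "x \<in> std_simplex n"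
    then have "x i \<le> 1" if "i < n" for i
      using sum_nonneg_leq_bound[of "{..<n}" x 1 i] that by (auto simp: std_simplex_def)
    with x show "x \<in> ?B \<inter> {x. (\<Sum>i<n. x i) = 1}"
      by (simp add: std_simplex_def PiE_iff)
  next
    fix x assume x: "x \<in> ?B \<inter> {x. (\<Sum>i<n. x i) = 1}"
    then have xi: "x i \<in> (if i < n then {0..1} else {0})" for i by (simp add: PiE_iff)
    have "0 \<le> x i" if "i < n" for i using xi[of i] that by simp
    moreover have "x i = 0" if "i \<ge> n" for i using xi[of i] that by simp
    ultimately show "x \<in> std_simplex n" using x by (simp add: std_simplex_def)
  qed
  finally show ?thesis .
qed

lemma continuous_on_quad_form_vector: "continuous_on UNIV (\<lambda>x. quad_form n A x)"
  unfolding quad_form_def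
  by (intro continuous_on_sum continuous_on_mult continuous_on_const continuous_on_product_coordinates)

lemma continuous_on_quad_form_matrix: "continuous_on UNIV (\<lambda>A. quad_form n A x)"
proof -
  have "continuous_on UNIV (\<lambda>A::nat \<Rightarrow> nat \<Rightarrow> real. A i j)" for i j
    by (rule continuous_on_product_then_coordinatewise[OF continuous_on_product_coordinates])
  then show ?thesis
    unfolding quad_form_def by (intro continuous_on_sum continuous_on_mult continuous_on_const)
qed

lemma vertex_in_std_simplex: "i < n \<Longrightarrow> (\<lambda>j. if j = i then 1 else 0) \<in> std_simplex n"
  by (auto simp: std_simplex_def)

definition minimizer_meets :: "nat \<Rightarrow> (nat \<Rightarrow> real) set \<Rightarrow> (nat \<Rightarrow> nat \<Rightarrow> real) \<Rightarrow> bool" where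
  "minimizer_meets n K A \<longleftrightarrow> (\<exists>x\<in>K. is_global_minimizer n A x)"

text \<open>
  By compactness the form attains its minimum over \<open>K\<close>, so \<open>K\<close> contains a global minimizer unless some rational level
  separates the infimum over the simplex from the infimum over \<open>K\<close>.
\<close>

lemma minimizer_meets_iff_rational_levels:
  assumes n: "n \<ge> 1" and K: "closed K" "K \<subseteq> std_simplex n"
  shows "minimizer_meets n K A \<longleftrightarrow>
    (\<forall>c::rat. (\<exists>y\<in>std_simplex n. quad_form n A y < of_rat c) \<longrightarrow> (\<exists>x\<in>K. quad_form n A x < of_rat c))"
    (is "_ \<longleftrightarrow> ?R")
proof
  assume "minimizer_meets n K A"
  then obtain x where "x \<in> K" "\<And>y. y \<in> std_simplex n \<Longrightarrow> quad_form n A x \<le> quad_form n A y"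
    unfolding minimizer_meets_def is_global_minimizer_def by blast
  then show ?R by (blast intro: le_less_trans)
next
  assume R: ?R
  let ?e = "\<lambda>j. if j = 0 then 1 else (0::real)"
  obtain c where c: "quad_form n A ?e < of_rat c"
    using of_rat_dense[of "quad_form n A ?e" "quad_form n A ?e + 1"] by auto
  then have "K \<noteq> {}" using R vertex_in_std_simplex[of 0 n] n by force
  moreover have "compact K"
    using compact_Int_closed[OF compact_std_simplex K(1), of n] K(2) by (simp add: Int_absorb1)
  ultimately obtain x where x: "x \<in> K" "\<forall>y\<in>K. quad_form n A x \<le> quad_form n A y"
    using continuous_attains_inf[of K "quad_form n A"]
      continuous_on_subset[OF continuous_on_quad_form_vector] by blast
  have "quad_form n A x \<le> quad_form n A y" if y: "y \<in> std_simplex n" for y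
  proof (rule ccontr)
    assume "\<not> ?thesis"
    then obtain c where "quad_form n A y < of_rat c" "of_rat c < quad_form n A x"
      using of_rat_dense[of "quad_form n A y" "quad_form n A x"] by auto
    then show False using R x y by force
  qed
  then show "minimizer_meets n K A"
    using x K unfolding minimizer_meets_def is_global_minimizer_def by blast
qed

lemma exists_global_minimizer: "n \<ge> 1 \<Longrightarrow> \<exists>x. is_global_minimizer n A x"
  using minimizer_meets_iff_rational_levels[of n "std_simplex n" A] compact_imp_closed[OF compact_std_simplex]
  by (auto simp: minimizer_meets_def)

text \<open>
  For a fixed level, the matrices for which the form drops below that level somewhere on \<open>X\<close> form a union of open
  sets, one for each point of \<open>X\<close>.
\<close>

lemma measurable_minimizer_meets:
  assumes "n \<ge> 1" "closed K" "K \<subseteq> std_simplex n"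
  shows "Measurable.pred borel (minimizer_meets n K)"
proof -
  have [measurable]: "Measurable.pred borel (\<lambda>A. \<exists>x\<in>X. quad_form n A x < c)" for X c
  proof -
    have "{A. \<exists>x\<in>X. quad_form n A x < c} = (\<Union>x\<in>X. {A. quad_form n A x < c})" by auto
    moreover have "open \<dots>"
      by (intro open_UN ballI open_Collect_less continuous_on_quad_form_matrix continuous_on_const)
    ultimately show ?thesis by (simp add: pred_def borel_open)
  qed
  have "Measurable.pred borel (\<lambda>A. \<forall>c::rat. (\<exists>y\<in>std_simplex n. quad_form n A y < of_rat c)
      \<longrightarrow> (\<exists>x\<in>K. quad_form n A x < of_rat c))"
    by measurable
  also have "(\<lambda>A. \<forall>c::rat. (\<exists>y\<in>std_simplex n. quad_form n A y < of_rat c)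
      \<longrightarrow> (\<exists>x\<in>K. quad_form n A x < of_rat c)) = minimizer_meets n K"
    by (rule ext, rule minimizer_meets_iff_rational_levels[OF assms, symmetric])
  finally show ?thesis .
qed

definition low_slice :: "nat \<Rightarrow> nat \<Rightarrow> real \<Rightarrow> (nat \<Rightarrow> real) set" where
  "low_slice n i p = {x \<in> std_simplex n. x i \<le> p}"

definition high_slice :: "nat \<Rightarrow> nat \<Rightarrow> real \<Rightarrow> (nat \<Rightarrow> real) set" where
  "high_slice n i p = {x \<in> std_simplex n. p \<le> x i}"

lemma closed_slices: "closed (low_slice n i p)" "closed (high_slice n i p)"
proof -
  note std = compact_imp_closed[OF compact_std_simplex, of n]
  have "closed {x :: nat \<Rightarrow> real. x i \<le> p}" "closed {x :: nat \<Rightarrow> real. p \<le> x i}"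
    by (rule closed_Collect_le[OF continuous_on_product_coordinates continuous_on_const],
        rule closed_Collect_le[OF continuous_on_const continuous_on_product_coordinates])
  then have "closed (std_simplex n \<inter> {x. x i \<le> p})" "closed (std_simplex n \<inter> {x. p \<le> x i})"
    using std by (auto intro: closed_Int)
  then show "closed (low_slice n i p)" "closed (high_slice n i p)"
    by (simp_all add: low_slice_def high_slice_def Int_def)
qed

lemma slices_subset: "low_slice n i p \<subseteq> std_simplex n" "high_slice n i p \<subseteq> std_simplex n"
  by (auto simp: low_slice_def high_slice_def)

definition minimizers_separated :: "nat \<Rightarrow> nat \<Rightarrow> real \<Rightarrow> real \<Rightarrow> (nat \<Rightarrow> nat \<Rightarrow> real) \<Rightarrow> bool" where
  "minimizers_separated n i p q A \<longleftrightarrow>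
     p < q \<and> minimizer_meets n (low_slice n i p) A \<and> minimizer_meets n (high_slice n i q) A"

lemma measurable_minimizers_separated:
  "n \<ge> 1 \<Longrightarrow> Measurable.pred borel (minimizers_separated n i p q)"
  unfolding minimizers_separated_def[abs_def]
  by (intro pred_intros_logic(3) measurable_minimizer_meets closed_slices slices_subset) auto

lemma unique_minimizer_iff:
  assumes "n \<ge> 1"
  shows "(\<exists>!x. is_global_minimizer n A x) \<longleftrightarrow> \<not> (\<exists>i<n. \<exists>p q. minimizers_separated n i (of_rat p) (of_rat q) A)"
    (is "?L \<longleftrightarrow> \<not> ?R")
proof
  assume ?L
  then show "\<not> ?R"
    by (force simp: minimizers_separated_def minimizer_meets_def low_slice_def high_slice_def)
next
  assume R: "\<not> ?R"
  obtain x where x: "is_global_minimizer n A x" using exists_global_minimizer[OF assms] by blast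
  have le: "y i \<le> z i" if yz: "is_global_minimizer n A y" "is_global_minimizer n A z" and "i < n" for y z i
  proof (rule ccontr)
    assume "\<not> ?thesis"
    then obtain p where "z i < of_rat p" "of_rat p < y i" using of_rat_dense[of "z i" "y i"] by auto
    moreover from this obtain q where "of_rat p < (of_rat q :: real)" "of_rat q < y i"
      using of_rat_dense[of "of_rat p" "y i"] by auto
    ultimately have "minimizers_separated n i (of_rat p) (of_rat q) A"
      using yz by (auto simp: minimizers_separated_def minimizer_meets_def low_slice_def high_slice_def
          is_global_minimizer_def intro: less_imp_le)
    then show False using R \<open>i < n\<close> by blast
  qed
  have "y = x" if y: "is_global_minimizer n A y" for y
  proof
    fix i show "y i = x i"
    proof (cases "i < n")
      case True then show ?thesis using le[OF x y] le[OF y x] by (simp add: antisym)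
    next
      case False then show ?thesis using x y by (auto simp: is_global_minimizer_def std_simplex_def)
    qed
  qed
  then show ?L using x by blast
qed

lemma measurable_unique_minimizer:
  assumes "n \<ge> 1"
  shows "Measurable.pred borel (\<lambda>A. \<exists>!x. is_global_minimizer n A x)"
proof -
  note measurable_minimizers_separated[OF assms, measurable]
  have "Measurable.pred borel (\<lambda>A. \<not> (\<exists>i\<in>{..<n}. \<exists>p q. minimizers_separated n i (of_rat p) (of_rat q) A))"
    by measurable
  then show ?thesis by (simp add: unique_minimizer_iff[OF assms] Bex_def)
qed

text \<open>
  When the minimizer is unique, its coordinate \<open>i\<close> is positive exactly if no minimizer lies in the slice \<open>x i \<le> 0\<close>. This
  expresses the support size through conditions already known to be measurable.
\<close>

lemma kappa_eq_sum:
  assumes "n \<ge> 1"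
  shows "kappa n A = (if \<exists>!x. is_global_minimizer n A x
     then \<Sum>i<n. if minimizer_meets n (low_slice n i 0) A then 0 else 1 else 0)"
proof (cases "\<exists>!x. is_global_minimizer n A x")
  case True
  define x where "x = (THE x. is_global_minimizer n A x)"
  have x: "is_global_minimizer n A x" using theI'[OF True] by (simp add: x_def)
  have "minimizer_meets n (low_slice n i 0) A \<longleftrightarrow> \<not> 0 < x i" for i
    using x True by (auto simp: minimizer_meets_def low_slice_def is_global_minimizer_def not_less)
  then have "(\<Sum>i<n. if minimizer_meets n (low_slice n i 0) A then 0 else 1) = (\<Sum>i<n. if 0 < x i then 1 else 0::nat)"
    by (intro sum.cong) auto
  also have "\<dots> = card {i. i < n \<and> 0 < x i}"
    by (simp add: sum.If_cases Int_def lessThan_def)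
  finally show ?thesis using True by (simp add: kappa_def x_def)
qed (simp add: kappa_def)

lemma measurable_kappa:
  assumes "n \<ge> 1"
  shows "kappa n \<in> measurable borel (count_space UNIV)"
proof -
  have "Measurable.pred borel (minimizer_meets n (low_slice n i 0))" for i
    by (intro measurable_minimizer_meets assms closed_slices slices_subset)
  then have "(\<lambda>A. if \<exists>!x. is_global_minimizer n A x
     then \<Sum>i<n. if minimizer_meets n (low_slice n i 0) A then 0 else 1 else (0::real)) \<in> borel_measurable borel"
    using measurable_unique_minimizer[OF assms]
    by (intro measurable_If borel_measurable_sum) (simp_all add: pred_def)
  also have "(\<lambda>A. if \<exists>!x. is_global_minimizer n A x
     then \<Sum>i<n. if minimizer_meets n (low_slice n i 0) A then 0 else 1 else (0::real)) = (\<lambda>A. real (kappa n A))"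
    by (simp add: kappa_eq_sum[OF assms] fun_eq_iff if_distrib[of real] cong: if_cong)
  finally have "(\<lambda>A. real (kappa n A)) -` {real k} \<inter> space borel \<in> sets borel" for k
    by (rule measurable_sets) simp
  moreover have "(\<lambda>A. real (kappa n A)) -` {real k} = kappa n -` {k}" for k by auto
  ultimately show ?thesis
    by (subst measurable_count_space_eq2_countable) auto
qed

section \<open>Almost sure uniqueness of the minimizer\<close>

definition set_diag :: "nat \<Rightarrow> (nat \<Rightarrow> nat \<Rightarrow> real) \<Rightarrow> real \<Rightarrow> nat \<Rightarrow> nat \<Rightarrow> real" where
  "set_diag i A s = (\<lambda>k l. if k = i \<and> l = i then s else A k l)"

lemma quad_form_set_diag:
  assumes "i < n"
  shows "quad_form n (set_diag i A s) x = quad_form n (set_diag i A t) x + (s - t) * (x i)\<^sup>2"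
proof -
  have "quad_form n (set_diag i A s) x
     = quad_form n (set_diag i A t) x + (\<Sum>k<n. \<Sum>l<n. if l = i then if k = i then (s - t) * (x i)\<^sup>2 else 0 else 0)"
    unfolding quad_form_def sum.distrib[symmetric]
    by (intro sum.cong refl) (auto simp: set_diag_def algebra_simps power2_eq_square)
  then show ?thesis using assms by simp
qed

text \<open>
  Raising the diagonal entry \<open>i\<close> from \<open>s\<close> to \<open>t\<close> adds \<open>(t - s) * (x i)\<^sup>2\<close> to the form. Adding up the minimality of a minimizer
  \<open>x\<close> for \<open>s\<close> and of a minimizer \<open>y\<close> for \<open>t\<close> gives \<open>y i \<le> x i\<close>.
\<close>

lemma minimizers_separated_at_most_once:
  assumes "i < n" "s < t"
  shows "\<not> (minimizers_separated n i p q (set_diag i A s) \<and> minimizers_separated n i p q (set_diag i A t))"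
proof
  assume *: "minimizers_separated n i p q (set_diag i A s) \<and> minimizers_separated n i p q (set_diag i A t)"
  then obtain x y where xy: "x i \<le> p" "is_global_minimizer n (set_diag i A s) x"
      "q \<le> y i" "is_global_minimizer n (set_diag i A t) y" and pq: "p < q"
    by (auto simp: minimizers_separated_def minimizer_meets_def low_slice_def high_slice_def)
  then have x0: "0 \<le> x i" using assms by (auto simp: is_global_minimizer_def std_simplex_def)
  have "quad_form n (set_diag i A s) x \<le> quad_form n (set_diag i A s) y"
    "quad_form n (set_diag i A t) y \<le> quad_form n (set_diag i A t) x"
    using xy by (auto simp: is_global_minimizer_def)
  then have "(t - s) * (y i)\<^sup>2 \<le> (t - s) * (x i)\<^sup>2"
    using quad_form_set_diag[OF assms(1), of A t x s] quad_form_set_diag[OF assms(1), of A t y s] by linarith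
  then have "(y i)\<^sup>2 \<le> (x i)\<^sup>2" using assms(2) by simp
  then have "y i \<le> x i" using x0 by (rule power2_le_imp_le)
  then show False using xy pq by linarith
qed

abbreviation entry_sd :: "nat \<times> nat \<Rightarrow> real" where
  "entry_sd p \<equiv> (if fst p = snd p then 1 else sqrt (1/2))"

lemma GOE_entry:
  assumes "GOE n M Q" "i \<le> j" "j < n"
  shows "distributed M lborel (\<lambda>\<omega>. Q \<omega> i j) (normal_density 0 (entry_sd (i, j)))"
  using assms by (cases "i = j") (auto simp: GOE_def)

lemma GOE_entry_measurable:
  assumes "GOE n M Q" "i < n" "j < n"
  shows "(\<lambda>\<omega>. Q \<omega> i j) \<in> borel_measurable M"
proof -
  have *: "(\<lambda>\<omega>. Q \<omega> i j) \<in> borel_measurable M" if "i \<le> j" "j < n" for i j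
    using distributed_measurable[OF GOE_entry[OF assms(1) that]] by simp
  show ?thesis
  proof (cases "i \<le> j")
    case False
    then have "(\<lambda>\<omega>. Q \<omega> i j) \<in> borel_measurable M \<longleftrightarrow> (\<lambda>\<omega>. Q \<omega> j i) \<in> borel_measurable M"
      using assms by (intro measurable_cong) (auto simp: GOE_def)
    then show ?thesis using * False assms by simp
  qed (use * assms in auto)
qed

text \<open>
  The independent coordinates of the ensemble are the entries on and above the diagonal, and entries outside the
  \<open>n \<times> n\<close> square are arbitrary, possibly nonmeasurable, functions. This is the matrix rebuilt from the
  relevant coordinates \<open>u\<close> only.
\<close>

definition upper_matrix :: "nat \<Rightarrow> (nat \<times> nat \<Rightarrow> real) \<Rightarrow> nat \<Rightarrow> nat \<Rightarrow> real" where
  "upper_matrix n u = (\<lambda>k l. if k < n \<and> l < n then u (min k l, max k l) else 0)"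

lemma is_global_minimizer_cong:
  assumes "\<And>i j. i < n \<Longrightarrow> j < n \<Longrightarrow> A i j = B i j"
  shows "is_global_minimizer n A = is_global_minimizer n B"
proof -
  have "quad_form n A = quad_form n B"
    using assms by (auto simp: quad_form_def fun_eq_iff intro!: sum.cong)
  then show ?thesis by (simp add: is_global_minimizer_def fun_eq_iff)
qed

lemma GOE_minimizer_upper_matrix:
  assumes "GOE n M Q" "\<omega> \<in> space M"
  shows "is_global_minimizer n (Q \<omega>) = is_global_minimizer n (upper_matrix n (\<lambda>(i, j). Q \<omega> i j))"
  using assms by (intro is_global_minimizer_cong) (auto simp: upper_matrix_def GOE_def min_def max_def)

lemma measurable_upper_matrix:
  assumes "\<And>i j. i \<le> j \<Longrightarrow> j < n \<Longrightarrow> (\<lambda>\<omega>. f \<omega> (i, j)) \<in> borel_measurable M"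
  shows "(\<lambda>\<omega>. upper_matrix n (f \<omega>)) \<in> borel_measurable M"
proof (intro measurable_coordinatewise_then_product)
  fix k l
  show "(\<lambda>\<omega>. upper_matrix n (f \<omega>) k l) \<in> borel_measurable M"
    using assms[of "min k l" "max k l"] by (cases "k < n \<and> l < n") (auto simp: upper_matrix_def)
qed

lemma GOE_kappa_measurable:
  assumes n: "n \<ge> 1" and G: "GOE n M Q"
  shows "(\<lambda>\<omega>. kappa n (Q \<omega>)) \<in> measurable M (count_space UNIV)"
proof -
  have "(\<lambda>\<omega>. upper_matrix n (\<lambda>(i, j). Q \<omega> i j)) \<in> borel_measurable M"
    by (rule measurable_upper_matrix) (use GOE_entry_measurable[OF G] in auto)
  then have "(\<lambda>\<omega>. kappa n (upper_matrix n (\<lambda>(i, j). Q \<omega> i j))) \<in> measurable M (count_space UNIV)"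
    by (rule measurable_compose[OF _ measurable_kappa[OF n]])
  also have "?this \<longleftrightarrow> ?thesis"
    by (intro measurable_cong) (simp add: kappa_def GOE_minimizer_upper_matrix[OF G])
  finally show ?thesis .
qed

text \<open>
  The diagonal entry \<open>i\<close> is independent of all other entries and has no atoms, and once the other entries are fixed the
  event leaves at most one value for it.
\<close>

lemma GOE_minimizers_separated_null:
  assumes n: "n \<ge> 1" and G: "GOE n M Q" and i: "i < n"
  shows "AE \<omega> in M. \<not> minimizers_separated n i p q (upper_matrix n (\<lambda>(i, j). Q \<omega> i j))"
proof -
  interpret prob_space M using G by (simp add: GOE_def)
  let ?I = "{(k, l). k \<le> l \<and> l < n}" and ?a = "(i, i)"
  let ?q = "\<lambda>(k, l) \<omega>. Q \<omega> k l"
  let ?X = "\<lambda>\<omega>. restrict (\<lambda>e. ?q e \<omega>) {?a}" and ?Y = "\<lambda>\<omega>. restrict (\<lambda>e. ?q e \<omega>) (?I - {?a})"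
  let ?S = "PiM {?a} (\<lambda>_. borel :: real measure)" and ?T = "PiM (?I - {?a}) (\<lambda>_. borel :: real measure)"
  \<comment> \<open>The matrix as a function of the pair formed by the diagonal entry \<open>i\<close> and all other entries.\<close>
  let ?glue = "\<lambda>z. upper_matrix n (\<lambda>e. if e = ?a then fst z e else snd z e)"
  let ?V = "?glue -` {A. minimizers_separated n i p q A} \<inter> space (?S \<Otimes>\<^sub>M ?T)"
  have "indep_vars (\<lambda>_. borel) ?q ?I" using G by (simp add: GOE_def)
  then have "indep_var ?S ?X ?T ?Y"
    by (rule indep_var_restrict) (use i in auto)
  then have rv: "random_variable ?S ?X" "random_variable ?T ?Y"
    and prod: "distr M ?S ?X \<Otimes>\<^sub>M distr M ?T ?Y = distr M (?S \<Otimes>\<^sub>M ?T) (\<lambda>\<omega>. (?X \<omega>, ?Y \<omega>))"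
    by (auto simp: indep_var_distribution_eq)
  interpret X: prob_space "distr M ?S ?X" by (rule prob_space_distr[OF rv(1)])
  interpret Y: prob_space "distr M ?T ?Y" by (rule prob_space_distr[OF rv(2)])
  interpret XY: pair_prob_space "distr M ?S ?X" "distr M ?T ?Y" ..
  have glue: "?glue \<in> borel_measurable (?S \<Otimes>\<^sub>M ?T)"
  proof (rule measurable_upper_matrix)
    fix k l :: nat assume kl: "k \<le> l" "l < n"
    show "(\<lambda>z. if (k, l) = ?a then fst z (k, l) else snd z (k, l)) \<in> borel_measurable (?S \<Otimes>\<^sub>M ?T)"
    proof (cases "(k, l) = ?a")
      case True
      have "(\<lambda>z. fst z (i, i)) \<in> borel_measurable (?S \<Otimes>\<^sub>M ?T)"
        by (rule measurable_compose[OF measurable_fst measurable_component_singleton]) simp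
      then show ?thesis using True by simp
    next
      case False
      have "(\<lambda>z. snd z (k, l)) \<in> borel_measurable (?S \<Otimes>\<^sub>M ?T)"
        by (rule measurable_compose[OF measurable_snd measurable_component_singleton]) (use kl False in auto)
      then show ?thesis by (simp only: if_not_P[OF False])
    qed
  qed
  have sep: "{A. minimizers_separated n i p q A} \<in> sets borel"
    using measurable_minimizers_separated[OF n, of i p q] by (simp add: pred_def)
  have V: "?V \<in> sets (?S \<Otimes>\<^sub>M ?T)" by (rule measurable_sets[OF glue sep])
  \<comment> \<open>The Gaussian diagonal entry takes no single value with positive probability.\<close>
  have atom: "emeasure (distr M ?S ?X) {u \<in> space ?S. u ?a = s} = 0" for s
  proof -
    have ms: "{u \<in> space ?S. u ?a = s} \<in> sets ?S"
      by measurable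
    have "emeasure (distr M ?S ?X) {u \<in> space ?S. u ?a = s} = emeasure M (?X -` {u \<in> space ?S. u ?a = s} \<inter> space M)"
      by (rule emeasure_distr[OF rv(1) ms])
    also have "\<dots> \<le> emeasure M ((\<lambda>\<omega>. Q \<omega> i i) -` {s} \<inter> space M)"
      using GOE_entry_measurable[OF G i i] by (intro emeasure_mono) (auto intro: measurable_sets)
    also have "\<dots> = (\<integral>\<^sup>+x. ennreal (normal_density 0 1 x) * indicator {s} x \<partial>lborel)"
      using G i by (intro distributed_emeasure) (auto simp: GOE_def)
    also have "\<dots> = 0"
      by (rule nn_integral_null_set) (simp add: countable_imp_null_set_lborel)
    finally show ?thesis by simp
  qed
  have "emeasure M ((\<lambda>\<omega>. (?X \<omega>, ?Y \<omega>)) -` ?V \<inter> space M) = emeasure (distr M ?S ?X \<Otimes>\<^sub>M distr M ?T ?Y) ?V"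
    unfolding prod by (rule emeasure_distr[symmetric, OF _ V]) (use rv in measurable)
  also have "\<dots> = (\<integral>\<^sup>+v. emeasure (distr M ?S ?X) ((\<lambda>u. (u, v)) -` ?V) \<partial>distr M ?T ?Y)"
    by (rule XY.emeasure_pair_measure_alt2) (use V in \<open>simp cong: sets_pair_measure_cong\<close>)
  also have "\<dots> = (\<integral>\<^sup>+v. 0 \<partial>distr M ?T ?Y)"
  proof (intro nn_integral_cong)
    fix v
    let ?B = "upper_matrix n (\<lambda>e. if e = ?a then 0 else v e)"
    \<comment> \<open>With the other entries \<open>v\<close> fixed, only the diagonal entry \<open>i\<close> of the matrix varies.\<close>
    have g: "?glue (u, v) = set_diag i ?B (u ?a)" for u
      using i by (auto simp: upper_matrix_def set_diag_def fun_eq_iff min_def max_def)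
    have "\<exists>s. (\<lambda>u. (u, v)) -` ?V \<subseteq> {u \<in> space ?S. u ?a = s}"
    proof (cases "\<exists>u. (u, v) \<in> ?V")
      case True
      then obtain u where u: "(u, v) \<in> ?V" by blast
      have "w ?a = u ?a" if w: "(w, v) \<in> ?V" for w
      proof (rule ccontr)
        assume "w ?a \<noteq> u ?a"
        then have "w ?a < u ?a \<or> u ?a < w ?a" by linarith
        then show False
          using minimizers_separated_at_most_once[OF i, of "w ?a" "u ?a" p q ?B]
            minimizers_separated_at_most_once[OF i, of "u ?a" "w ?a" p q ?B] u w g by auto
      qed
      then show ?thesis by (intro exI[of _ "u ?a"]) (auto simp: space_pair_measure)
    qed auto
    then obtain s where s: "(\<lambda>u. (u, v)) -` ?V \<subseteq> {u \<in> space ?S. u ?a = s}" by blast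
    have "emeasure (distr M ?S ?X) ((\<lambda>u. (u, v)) -` ?V) \<le> emeasure (distr M ?S ?X) {u \<in> space ?S. u ?a = s}"
      by (rule emeasure_mono[OF s]) measurable
    then show "emeasure (distr M ?S ?X) ((\<lambda>u. (u, v)) -` ?V) = 0" using atom[of s] by simp
  qed
  finally have null: "emeasure M ((\<lambda>\<omega>. (?X \<omega>, ?Y \<omega>)) -` ?V \<inter> space M) = 0" by simp
  have "(\<lambda>\<omega>. (?X \<omega>, ?Y \<omega>)) -` ?V \<inter> space M \<in> sets M"
    by (rule measurable_sets[OF _ V]) (use rv in measurable)
  with null have nullset: "(\<lambda>\<omega>. (?X \<omega>, ?Y \<omega>)) -` ?V \<inter> space M \<in> null_sets M" by (simp add: null_sets_def)
  have "upper_matrix n (\<lambda>(i, j). Q \<omega> i j) = ?glue (?X \<omega>, ?Y \<omega>)" for \<omega>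
    by (auto simp: upper_matrix_def fun_eq_iff min_def max_def)
  then have "{\<omega> \<in> space M. minimizers_separated n i p q (upper_matrix n (\<lambda>(i, j). Q \<omega> i j))}
      \<subseteq> (\<lambda>\<omega>. (?X \<omega>, ?Y \<omega>)) -` ?V \<inter> space M"
    by (auto simp: space_pair_measure space_PiM)
  then show ?thesis by (intro AE_I'[OF nullset]) auto
qed

lemma GOE_unique_minimizer:
  assumes n: "n \<ge> 1" and G: "GOE n M Q"
  shows "AE \<omega> in M. \<exists>!x. is_global_minimizer n (Q \<omega>) x"
proof -
  have "AE \<omega> in M. \<forall>i\<in>{..<n}. \<forall>p q. \<not> minimizers_separated n i (of_rat p) (of_rat q) (upper_matrix n (\<lambda>(i, j). Q \<omega> i j))"
    using GOE_minimizers_separated_null[OF n G] by (intro AE_finite_allI) (auto simp: AE_all_countable)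
  then show ?thesis
  proof (rule AE_mp, intro AE_I2 impI)
    fix \<omega> assume w: "\<omega> \<in> space M"
      and *: "\<forall>i\<in>{..<n}. \<forall>p q. \<not> minimizers_separated n i (of_rat p) (of_rat q) (upper_matrix n (\<lambda>(i, j). Q \<omega> i j))"
    show "\<exists>!x. is_global_minimizer n (Q \<omega>) x"
      unfolding GOE_minimizer_upper_matrix[OF G w] unique_minimizer_iff[OF n] using * by blast
  qed
qed

section \<open>Gaussian tail estimates\<close>

lemma gaussian_square_exp_moment:
  assumes X: "distributed M lborel X (normal_density 0 s)" and s: "s > 0" and c: "c < 1"
  shows "(\<integral>\<^sup>+\<omega>. ennreal (exp (c / 2 * ((X \<omega>)\<^sup>2 / s\<^sup>2))) \<partial>M) = ennreal (1 / sqrt (1 - c))"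
proof -
  let ?s = "s / sqrt (1 - c)"
  have eq: "normal_density 0 s x * exp (c / 2 * (x\<^sup>2 / s\<^sup>2)) = 1 / sqrt (1 - c) * normal_density 0 ?s x" for x
  proof -
    have "exp (- x\<^sup>2 / (2 * s\<^sup>2)) * exp (c / 2 * (x\<^sup>2 / s\<^sup>2)) = exp (- x\<^sup>2 / (2 * ?s\<^sup>2))"
      using s c by (simp add: exp_add[symmetric] field_simps power_divide)
    moreover have "sqrt (2 * pi * ?s\<^sup>2) = sqrt (2 * pi * s\<^sup>2) / sqrt (1 - c)"
      using s c by (simp add: power_divide real_sqrt_divide real_sqrt_mult)
    ultimately show ?thesis using s c by (simp add: normal_density_def mult.commute)
  qed
  have "(\<integral>\<^sup>+\<omega>. ennreal (exp (c / 2 * ((X \<omega>)\<^sup>2 / s\<^sup>2))) \<partial>M)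
      = (\<integral>\<^sup>+x. ennreal (normal_density 0 s x) * ennreal (exp (c / 2 * (x\<^sup>2 / s\<^sup>2))) \<partial>lborel)"
    by (rule distributed_nn_integral[OF X, symmetric]) measurable
  also have "\<dots> = (\<integral>\<^sup>+x. ennreal (1 / sqrt (1 - c)) * ennreal (normal_density 0 ?s x) \<partial>lborel)"
  proof (intro nn_integral_cong)
    fix x
    show "ennreal (normal_density 0 s x) * ennreal (exp (c / 2 * (x\<^sup>2 / s\<^sup>2)))
        = ennreal (1 / sqrt (1 - c)) * ennreal (normal_density 0 ?s x)"
      using eq[of x] by (simp add: ennreal_mult''[symmetric])
  qed
  also have "\<dots> = ennreal (1 / sqrt (1 - c)) * (\<integral>\<^sup>+x. ennreal (normal_density 0 ?s x) \<partial>lborel)"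
    by (rule nn_integral_cmult) measurable
  also have "(\<integral>\<^sup>+x. ennreal (normal_density 0 ?s x) \<partial>lborel) = 1"
    using prob_space.emeasure_space_1[OF prob_space_normal_density[of ?s 0]] s c
    by (simp add: emeasure_density)
  finally show ?thesis by simp
qed

text \<open>
  An off-diagonal entry occurs twice in the Frobenius norm and has variance \<open>1 / 2\<close>: in terms of the normalized independent
  entries, every square has weight one.
\<close>

lemma frob2_upper_sum:
  fixes A :: "nat \<Rightarrow> nat \<Rightarrow> real"
  assumes fin: "finite T" and sym: "\<And>i j. i \<in> T \<Longrightarrow> j \<in> T \<Longrightarrow> A i j = A j i"
  shows "frob2 T A = (\<Sum>(i, j)\<in>{(i, j). i \<in> T \<and> j \<in> T \<and> i \<le> j}. (A i j)\<^sup>2 / (if i = j then 1 else sqrt (1/2))\<^sup>2)"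
proof -
  let ?le = "{(i, j). i \<in> T \<and> j \<in> T \<and> i \<le> j}" and ?D = "{(i, j). i \<in> T \<and> j \<in> T \<and> i = j}"
    and ?lt = "{(i, j). i \<in> T \<and> j \<in> T \<and> i < j}" and ?gt = "{(i, j). i \<in> T \<and> j \<in> T \<and> j < i}"
  let ?f = "\<lambda>(i, j). (A i j)\<^sup>2"
  have fins: "finite ?D" "finite ?lt" "finite ?gt"
    by (rule finite_subset[of _ "T \<times> T"]; use fin in auto)+
  have "frob2 T A = sum ?f (T \<times> T)" by (simp add: frob2_def sum.cartesian_product)
  also have "T \<times> T = ?D \<union> (?lt \<union> ?gt)" by auto
  also have "sum ?f \<dots> = sum ?f ?D + (sum ?f ?lt + sum ?f ?gt)"
    using fins by (subst sum.union_disjoint; (subst sum.union_disjoint)?; auto)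
  also have "sum ?f ?gt = sum ?f ?lt"
    by (rule sum.reindex_bij_witness[of _ prod.swap prod.swap]) (auto simp: sym)
  finally have 1: "frob2 T A = sum ?f ?D + 2 * sum ?f ?lt" by simp
  have "?le = ?D \<union> ?lt" by auto
  then have "(\<Sum>(i, j)\<in>?le. (A i j)\<^sup>2 / (if i = j then 1 else sqrt (1/2))\<^sup>2) =
     (\<Sum>(i, j)\<in>?D. (A i j)\<^sup>2 / (if i = j then 1 else sqrt (1/2))\<^sup>2) + (\<Sum>(i, j)\<in>?lt. (A i j)\<^sup>2 / (if i = j then 1 else sqrt (1/2))\<^sup>2)"
    using fins by (simp only:) (subst sum.union_disjoint; auto)
  also have "(\<Sum>(i, j)\<in>?D. (A i j)\<^sup>2 / (if i = j then 1 else sqrt (1/2))\<^sup>2) = sum ?f ?D"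
    by (intro sum.cong) auto
  also have "(\<Sum>(i, j)\<in>?lt. (A i j)\<^sup>2 / (if i = j then 1 else sqrt (1/2))\<^sup>2) = 2 * sum ?f ?lt"
    unfolding sum_distrib_left by (intro sum.cong) (auto simp: power_divide)
  finally show ?thesis using 1 by simp
qed

lemma GOE_frob2_measurable:
  assumes "GOE n M Q" "T \<subseteq> {..<n}"
  shows "(\<lambda>\<omega>. frob2 T (Q \<omega>)) \<in> borel_measurable M"
  unfolding frob2_def using assms
  by (intro borel_measurable_sum borel_measurable_power GOE_entry_measurable) auto

lemma GOE_frob2_exp_moment:
  assumes G: "GOE n M Q" and T: "T \<subseteq> {..<n}" and c: "0 \<le> c" "c < 1"
  shows "(\<integral>\<^sup>+\<omega>. ennreal (exp (c / 2 * frob2 T (Q \<omega>))) \<partial>M) \<le> ennreal ((1 / sqrt (1 - c)) ^ (card T)\<^sup>2)"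
proof -
  interpret prob_space M using G by (simp add: GOE_def)
  let ?I = "{(i, j). i \<in> T \<and> j \<in> T \<and> i \<le> j}"
  let ?X = "\<lambda>p \<omega>. exp (c / 2 * ((case p of (i, j) \<Rightarrow> Q \<omega> i j)\<^sup>2 / (entry_sd p)\<^sup>2))"
  have finT: "finite T" using T finite_subset by blast
  have finI: "finite ?I" by (rule finite_subset[of _ "T \<times> T"]) (use finT in auto)
  have "indep_vars (\<lambda>_. borel) (\<lambda>(i, j) \<omega>. Q \<omega> i j) {(i, j). i \<le> j \<and> j < n}"
    using G by (simp add: GOE_def)
  then have "indep_vars (\<lambda>_. borel) (\<lambda>(i, j) \<omega>. Q \<omega> i j) ?I"
    by (rule indep_vars_subset) (use T in auto)
  then have "indep_vars (\<lambda>_. borel) (\<lambda>p \<omega>. (\<lambda>x. ennreal (exp (c / 2 * (x\<^sup>2 / (entry_sd p)\<^sup>2)))) ((case p of (i, j) \<Rightarrow> (\<lambda>\<omega>. Q \<omega> i j)) \<omega>)) ?I"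
    by (rule indep_vars_compose2) measurable
  then have ind: "indep_vars (\<lambda>_. borel) (\<lambda>p \<omega>. ennreal (?X p \<omega>)) ?I"
    by (simp add: case_prod_unfold)
  have "(\<integral>\<^sup>+\<omega>. ennreal (exp (c / 2 * frob2 T (Q \<omega>))) \<partial>M) = (\<integral>\<^sup>+\<omega>. (\<Prod>p\<in>?I. ennreal (?X p \<omega>)) \<partial>M)"
  proof (intro nn_integral_cong)
    fix \<omega> assume w: "\<omega> \<in> space M"
    have "frob2 T (Q \<omega>) = (\<Sum>p\<in>?I. (case p of (i, j) \<Rightarrow> Q \<omega> i j)\<^sup>2 / (entry_sd p)\<^sup>2)"
      using frob2_upper_sum[OF finT, of "Q \<omega>"] G T w by (auto simp: GOE_def case_prod_unfold subset_iff)
    then show "ennreal (exp (c / 2 * frob2 T (Q \<omega>))) = (\<Prod>p\<in>?I. ennreal (?X p \<omega>))"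
      using finI by (simp only: prod_ennreal[OF less_imp_le[OF exp_gt_zero]] sum_distrib_left exp_sum)
  qed
  also have "\<dots> = (\<Prod>p\<in>?I. \<integral>\<^sup>+\<omega>. ennreal (?X p \<omega>) \<partial>M)"
    by (rule indep_vars_nn_integral[OF finI ind]) auto
  also have "\<dots> = (\<Prod>p\<in>?I. ennreal (1 / sqrt (1 - c)))"
  proof (intro prod.cong refl)
    fix p assume p: "p \<in> ?I"
    obtain i j where ij: "p = (i, j)" by (cases p)
    show "(\<integral>\<^sup>+\<omega>. ennreal (?X p \<omega>) \<partial>M) = ennreal (1 / sqrt (1 - c))"
      using gaussian_square_exp_moment[OF GOE_entry[OF G, of i j] _ c(2)] p T by (auto simp: ij)
  qed
  also have "\<dots> = ennreal ((1 / sqrt (1 - c)) ^ card ?I)"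
    using c by (simp add: ennreal_power)
  also have "\<dots> \<le> ennreal ((1 / sqrt (1 - c)) ^ (card T)\<^sup>2)"
  proof (intro ennreal_leI power_increasing)
    have "card ?I \<le> card (T \<times> T)" using finT by (intro card_mono) auto
    then show "card ?I \<le> (card T)\<^sup>2" by (simp add: card_cartesian_product power2_eq_square)
    show "1 \<le> 1 / sqrt (1 - c)" using c by simp
  qed
  finally show ?thesis .
qed

text \<open>
  Chernoff's bound with the exponential moment of parameter \<open>c / 2 < 1 / 2\<close>.
\<close>

lemma GOE_frob2_tail:
  assumes G: "GOE n M Q" and T: "T \<subseteq> {..<n}" and c: "0 \<le> c" "c < 1"
  shows "measure M {\<omega> \<in> space M. u \<le> frob2 T (Q \<omega>)} \<le> (1 / sqrt (1 - c)) ^ (card T)\<^sup>2 * exp (- c * u / 2)"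
proof -
  interpret prob_space M using G by (simp add: GOE_def)
  note [measurable] = GOE_frob2_measurable[OF G T]
  have "emeasure M {\<omega> \<in> space M. u \<le> frob2 T (Q \<omega>)}
     \<le> emeasure M {\<omega> \<in> space M. 1 \<le> ennreal (exp (- c * u / 2)) * ennreal (exp (c / 2 * frob2 T (Q \<omega>)))}"
  proof (intro emeasure_mono subsetI CollectI conjI)
    fix \<omega> assume "\<omega> \<in> {\<omega> \<in> space M. u \<le> frob2 T (Q \<omega>)}"
    then have "c * u \<le> c * frob2 T (Q \<omega>)" using c by (auto intro: mult_left_mono)
    then have "1 \<le> exp (- c * u / 2) * exp (c / 2 * frob2 T (Q \<omega>))"
      unfolding exp_add[symmetric] by simp
    then show "1 \<le> ennreal (exp (- c * u / 2)) * ennreal (exp (c / 2 * frob2 T (Q \<omega>)))"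
      unfolding ennreal_mult'[symmetric, OF exp_ge_zero] by (simp add: ennreal_leI flip: ennreal_1)
  qed auto
  also have "\<dots> \<le> ennreal (exp (- c * u / 2)) * (\<integral>\<^sup>+\<omega>. ennreal (exp (c / 2 * frob2 T (Q \<omega>))) * indicator (space M) \<omega> \<partial>M)"
    using nn_integral_Markov_inequality[of "\<lambda>\<omega>. ennreal (exp (c / 2 * frob2 T (Q \<omega>)))" "space M" M "ennreal (exp (- c * u / 2))"]
    by simp
  also have "\<dots> \<le> ennreal (exp (- c * u / 2)) * ennreal ((1 / sqrt (1 - c)) ^ (card T)\<^sup>2)"
    using GOE_frob2_exp_moment[OF G T c] by (intro mult_left_mono) (simp_all cong: nn_integral_cong)
  also have "\<dots> = ennreal ((1 / sqrt (1 - c)) ^ (card T)\<^sup>2 * exp (- c * u / 2))"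
    using c by (simp add: ennreal_mult' mult.commute)
  finally show ?thesis
    using c by (simp add: emeasure_eq_measure)
qed

lemma GOE_heavy_block_measurable:
  assumes G: "GOE n M Q"
  shows "{\<omega> \<in> space M. heavy_block n k u (Q \<omega>)} \<in> sets M"
proof -
  have "{\<omega> \<in> space M. u \<le> frob2 T (Q \<omega>)} \<in> sets M" if "T \<subseteq> {..<n}" for T
  proof -
    note [measurable] = GOE_frob2_measurable[OF G that]
    show ?thesis by measurable
  qed
  moreover have "{\<omega> \<in> space M. heavy_block n k u (Q \<omega>)}
      = (\<Union>T\<in>{T. T \<subseteq> {..<n} \<and> card T = k}. {\<omega> \<in> space M. u \<le> frob2 T (Q \<omega>)})"
    by (auto simp: heavy_block_def)
  ultimately show ?thesis by (simp only:) (intro sets.finite_UN; simp)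
qed

lemma GOE_heavy_block_tail:
  assumes G: "GOE n M Q" and c: "0 \<le> c" "c < 1"
  shows "measure M {\<omega> \<in> space M. heavy_block n k u (Q \<omega>)}
       \<le> real n ^ k * ((1 / sqrt (1 - c)) ^ k\<^sup>2 * exp (- c * u / 2))"
    (is "measure M ?E \<le> _")
proof -
  interpret prob_space M using G by (simp add: GOE_def)
  let ?F = "{T. T \<subseteq> {..<n} \<and> card T = k}"
  let ?e = "\<lambda>T. {\<omega> \<in> space M. u \<le> frob2 T (Q \<omega>)}"
  have eq: "?E = (\<Union>T\<in>?F. ?e T)" by (auto simp: heavy_block_def)
  have fin: "finite ?F" by simp
  have ms: "?e T \<in> sets M" if "T \<in> ?F" for T
  proof -
    have "T \<subseteq> {..<n}" using that by simp
    note [measurable] = GOE_frob2_measurable[OF G this]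
    show ?thesis by measurable
  qed
  have "prob ?E \<le> (\<Sum>T\<in>?F. prob (?e T))"
    unfolding eq using fin ms by (intro finite_measure_subadditive_finite) auto
  also have "\<dots> \<le> (\<Sum>T\<in>?F. (1 / sqrt (1 - c)) ^ k\<^sup>2 * exp (- c * u / 2))"
  proof (intro sum_mono)
    fix T assume "T \<in> ?F"
    then show "prob (?e T) \<le> (1 / sqrt (1 - c)) ^ k\<^sup>2 * exp (- c * u / 2)"
      using GOE_frob2_tail[OF G _ c, of T u] by auto
  qed
  also have "\<dots> = real (card ?F) * ((1 / sqrt (1 - c)) ^ k\<^sup>2 * exp (- c * u / 2))" by simp
  also have "\<dots> \<le> real n ^ k * ((1 / sqrt (1 - c)) ^ k\<^sup>2 * exp (- c * u / 2))"
  proof (intro mult_right_mono)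
    have "card ?F \<le> n ^ k"
      using binomial_le_pow[of k n] by (cases "k \<le> n") (auto simp: n_subsets binomial_eq_0)
    then show "real (card ?F) \<le> real n ^ k" by (metis of_nat_le_iff of_nat_power)
  qed (use c in auto)
  finally show "prob ?E \<le> real n ^ k * ((1 / sqrt (1 - c)) ^ k\<^sup>2 * exp (- c * u / 2))" .
qed

text \<open>
  On the interval from \<open>- v - 1\<close> to \<open>- v\<close>, of length one, the density is at least its value at \<open>v + 1\<close>.
\<close>

lemma normal_lower_tail:
  assumes "prob_space M" and X: "distributed M lborel X (normal_density 0 1)" and v: "v \<ge> 0"
  shows "measure M {\<omega> \<in> space M. - v < X \<omega>} \<le> 1 - normal_density 0 1 (v + 1)"
proof -
  interpret prob_space M by fact
  have [measurable]: "X \<in> borel_measurable M" using distributed_measurable[OF X] by simp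
  have "ennreal (normal_density 0 1 (v + 1)) = (\<integral>\<^sup>+x. ennreal (normal_density 0 1 (v + 1)) * indicator {-v-1..-v} x \<partial>lborel)"
    by (simp add: nn_integral_cmult_indicator)
  also have "\<dots> \<le> (\<integral>\<^sup>+x. ennreal (normal_density 0 1 x) * indicator {-v-1..-v} x \<partial>lborel)"
  proof (intro nn_integral_mono)
    fix x :: real
    have "normal_density 0 1 (v + 1) \<le> normal_density 0 1 x" if "- v - 1 \<le> x" "x \<le> - v"
    proof -
      have "x\<^sup>2 \<le> (v + 1)\<^sup>2" using that v by (intro abs_le_square_iff[THEN iffD1]) auto
      then show ?thesis by (simp add: normal_density_def divide_right_mono)
    qed
    then show "ennreal (normal_density 0 1 (v + 1)) * indicator {-v-1..-v} x \<le> ennreal (normal_density 0 1 x) * indicator {-v-1..-v} x"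
      by (auto split: split_indicator simp: ennreal_leI)
  qed
  also have "\<dots> = emeasure M (X -` {-v-1..-v} \<inter> space M)"
    by (rule distributed_emeasure[OF X, symmetric]) simp
  finally have "normal_density 0 1 (v + 1) \<le> prob (X -` {-v-1..-v} \<inter> space M)"
    by (simp add: emeasure_eq_measure)
  also have "\<dots> \<le> prob (space M - {\<omega> \<in> space M. - v < X \<omega>})"
    by (intro finite_measure_mono) auto
  also have "\<dots> = 1 - prob {\<omega> \<in> space M. - v < X \<omega>}" by (rule prob_compl) measurable
  finally show ?thesis by simp
qed

lemma GOE_min_diagonal_tail:
  assumes G: "GOE n M Q" and n: "n \<ge> 1" and v: "v \<ge> 0"
  shows "{\<omega> \<in> space M. \<forall>i<n. - v < Q \<omega> i i} \<in> sets M"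
    and "measure M {\<omega> \<in> space M. \<forall>i<n. - v < Q \<omega> i i} \<le> exp (- real n * normal_density 0 1 (v + 1))"
proof -
  interpret prob_space M using G by (simp add: GOE_def)
  let ?D = "(\<lambda>i. (i, i)) ` {..<n}"
  let ?X = "\<lambda>(i, j) \<omega>. Q \<omega> i j"
  have [measurable]: "(\<lambda>\<omega>. Q \<omega> i i) \<in> borel_measurable M" if "i < n" for i
    using GOE_entry_measurable[OF G that that] .
  have n0: "0 \<in> {..<n}" using n by simp
  have eq: "{\<omega> \<in> space M. \<forall>i<n. - v < Q \<omega> i i} = (\<Inter>p\<in>?D. ?X p -` {- v<..} \<inter> space M)"
    using n0 by (auto; blast)
  have eq': "{\<omega> \<in> space M. \<forall>i<n. - v < Q \<omega> i i} = (\<Inter>i\<in>{..<n}. {\<omega> \<in> space M. - v < Q \<omega> i i})"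
    using n0 by (auto; blast)
  show "{\<omega> \<in> space M. \<forall>i<n. - v < Q \<omega> i i} \<in> sets M"
    unfolding eq' using n0 by (intro sets.finite_INT) (auto simp del: lessThan_empty_iff)
  have "prob {\<omega> \<in> space M. \<forall>i<n. - v < Q \<omega> i i} = (\<Prod>p\<in>?D. prob (?X p -` {- v<..} \<inter> space M))"
    unfolding eq
    by (rule indep_varsD[of "\<lambda>_. borel" _ "{(i, j). i \<le> j \<and> j < n}"]) (use G n0 in \<open>auto simp: GOE_def simp del: lessThan_empty_iff\<close>)
  also have "\<dots> = (\<Prod>i<n. prob {\<omega> \<in> space M. - v < Q \<omega> i i})"
    by (subst prod.reindex) (auto simp: inj_on_def intro!: prod.cong arg_cong[where f = prob])
  also have "\<dots> \<le> (\<Prod>i<n. exp (- normal_density 0 1 (v + 1)))"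
  proof (intro prod_mono conjI)
    fix i assume "i \<in> {..<n}"
    then have "prob {\<omega> \<in> space M. - v < Q \<omega> i i} \<le> 1 - normal_density 0 1 (v + 1)"
      using G v by (intro normal_lower_tail) (auto simp: GOE_def)
    also have "\<dots> \<le> exp (- normal_density 0 1 (v + 1))"
      using exp_ge_add_one_self[of "- normal_density 0 1 (v + 1)"] by simp
    finally show "prob {\<omega> \<in> space M. - v < Q \<omega> i i} \<le> exp (- normal_density 0 1 (v + 1))" .
  qed auto
  also have "\<dots> = exp (- real n * normal_density 0 1 (v + 1))" by (simp add: exp_of_nat_mult[symmetric])
  finally show "prob {\<omega> \<in> space M. \<forall>i<n. - v < Q \<omega> i i} \<le> exp (- real n * normal_density 0 1 (v + 1))" .
qed

text \<open>
  The minimum of \<open>n\<close> standard normal variables is about \<open>- sqrt (2 * ln n)\<close>. For \<open>c < 1\<close> the level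
  \<open>- diag_level c n\<close> lies above it by a factor, and is exceeded by the minimum only with superpolynomially small
  probability.
\<close>

abbreviation diag_level :: "real \<Rightarrow> nat \<Rightarrow> real" where
  "diag_level c n \<equiv> sqrt (2 * c * ln (real n))"

text \<open>
  Up to a constant, \<open>n\<close> times the density is \<open>n powr (1 - c)\<close> times \<open>exp (- diag_level c n)\<close>. The latter factor decays
  more slowly than any negative power of \<open>n\<close>, and half of the exponent \<open>1 - c\<close> absorbs it.
\<close>

lemma diag_level_limit:
  assumes c: "0 < c" "c < 1"
  shows "(\<lambda>n. exp (- real n * normal_density 0 1 (sqrt (2 * c * ln (real n)) + 1)) * real n powr b) \<longlonglongrightarrow> 0"
proof -
  let ?K = "1 / sqrt (2 * pi)" and ?v = "\<lambda>n. sqrt (2 * c * ln (real n))"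
  have "filterlim (\<lambda>n. real n powr (1 - c) * exp (- ?v n - 1 / 2) / real n powr ((1 - c) / 2)) at_top sequentially"
    using c by real_asymp
  then have "eventually (\<lambda>n. real n powr (1 - c) * exp (- ?v n - 1 / 2) / real n powr ((1 - c) / 2) \<ge> 1) sequentially"
    by (simp add: filterlim_at_top)
  then have "eventually (\<lambda>n. norm (exp (- real n * normal_density 0 1 (?v n + 1)) * real n powr b)
      \<le> exp (- ?K * real n powr ((1 - c) / 2)) * real n powr b) sequentially"
    using eventually_ge_at_top[of 1]
  proof eventually_elim
    case (elim n)
    have "exp (- (?v n + 1)\<^sup>2 / 2) = real n powr (- c) * exp (- ?v n - 1 / 2)"
    proof -
      have v2: "(?v n)\<^sup>2 = 2 * c * ln (real n)" using elim c by simp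
      have "- (?v n + 1)\<^sup>2 / 2 = - c * ln (real n) + (- ?v n - 1 / 2)"
        unfolding power2_sum v2 by simp
      then show ?thesis using elim by (simp only: exp_add) (simp add: powr_def)
    qed
    then have "real n * normal_density 0 1 (?v n + 1) = ?K * (real n powr (1 - c) * exp (- ?v n - 1 / 2))"
    proof -
      have "real n powr (1 - c) = real n * real n powr (- c)"
        using elim powr_add[of "real n" 1 "- c"] by simp
      then show ?thesis
        unfolding std_normal_density_def \<open>exp (- (?v n + 1)\<^sup>2 / 2) = _\<close> by (simp only: mult_ac)
    qed
    also have "\<dots> \<ge> ?K * real n powr ((1 - c) / 2)"
      using elim by (intro mult_left_mono) (auto simp: le_divide_eq)
    finally show ?case by (simp add: mult_right_mono)
  qed
  moreover have "(\<lambda>n. exp (- ?K * real n powr ((1 - c) / 2)) * real n powr b) \<longlonglongrightarrow> 0"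
    using c by real_asymp
  ultimately show ?thesis by (rule Lim_null_comparison)
qed

lemma diag_level_decay:
  assumes c: "0 < c" "c < 1"
  obtains C where "C \<ge> 0"
    "\<And>n. n \<ge> 1 \<Longrightarrow> exp (- real n * normal_density 0 1 (diag_level c n + 1)) \<le> C * real n powr (- b)"
proof -
  have "Bseq (\<lambda>n. exp (- real n * normal_density 0 1 (diag_level c n + 1)) * real n powr b)"
    using convergentI[OF diag_level_limit[OF c]] convergent_imp_Bseq by blast
  then obtain C where C: "C > 0" "\<And>n. norm (exp (- real n * normal_density 0 1 (diag_level c n + 1)) * real n powr b) \<le> C"
    by (auto elim: BseqE)
  show thesis
  proof (rule that[of C])
    fix n :: nat assume "n \<ge> 1"
    then show "exp (- real n * normal_density 0 1 (diag_level c n + 1)) \<le> C * real n powr (- b)"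
      using C(2)[of n] by (simp add: powr_minus field_simps)
  qed (use C in simp)
qed

lemma GOE_heavy_block_poly:
  assumes G: "GOE n M Q" and n: "n \<ge> 1" and c: "0 \<le> c" "c < 1"
    and r: "real k - c\<^sup>2 * a \<le> r"
  shows "measure M {\<omega> \<in> space M. heavy_block n k (a * (diag_level c n)\<^sup>2) (Q \<omega>)}
     \<le> (1 / sqrt (1 - c)) ^ k\<^sup>2 * real n powr r"
proof -
  let ?u = "a * (diag_level c n)\<^sup>2"
  have "measure M {\<omega> \<in> space M. heavy_block n k ?u (Q \<omega>)}
       \<le> real n ^ k * ((1 / sqrt (1 - c)) ^ k\<^sup>2 * exp (- c * ?u / 2))"
    by (rule GOE_heavy_block_tail[OF G c])
  also have "real n ^ k = real n powr real k" using n by (simp add: powr_realpow)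
  also have "exp (- c * ?u / 2) = real n powr (- (c\<^sup>2 * a))"
    using n c by (simp add: powr_def power2_eq_square algebra_simps)
  also have "real n powr real k * ((1 / sqrt (1 - c)) ^ k\<^sup>2 * real n powr (- (c\<^sup>2 * a)))
      = (1 / sqrt (1 - c)) ^ k\<^sup>2 * real n powr (real k - c\<^sup>2 * a)"
    by (simp add: powr_diff powr_minus divide_inverse)
  also have "\<dots> \<le> (1 / sqrt (1 - c)) ^ k\<^sup>2 * real n powr r"
    using n c r by (intro mult_left_mono powr_mono) auto
  finally show ?thesis .
qed

section \<open>The distribution of the support size\<close>

lemma kappa_pos_minimizer:
  assumes "kappa n A = k" "k \<ge> 1"
  obtains x where "is_global_minimizer n A x" "card {i. i < n \<and> 0 < x i} = k"
  using assms theI'[of "is_global_minimizer n A"] by (auto simp: kappa_def split: if_splits)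

lemma kappa_le: "kappa n A \<le> n"
proof -
  have "card {i. i < n \<and> P i} \<le> n" for P using card_mono[of "{..<n}" "{i. i < n \<and> P i}"] by auto
  then show ?thesis by (simp add: kappa_def)
qed

text \<open>
  If some diagonal entry lies below the level, the support is a heavy block. The union bound over blocks has the exponent
  \<open>k - c\<^sup>2 * (2 * k - 1)\<close>, which tends to \<open>1 - k\<close> as \<open>c\<close> tends to \<open>1\<close>; the choice of \<open>c\<close> in the proof gives up at most \<open>1 / 2\<close>.
\<close>

lemma support_size_probability:
  assumes k: "k \<ge> 1"
  obtains C where "C \<ge> 0"
    "\<And>n (M :: 'a measure) Q. n \<ge> 1 \<Longrightarrow> GOE n M Q \<Longrightarrow>
       measure M {\<omega> \<in> space M. kappa n (Q \<omega>) = k} \<le> C * real n powr (3 / 2 - real k)"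
proof -
  define e where "e = 1 / (4 * (2 * real k - 1))"
  define c where "c = 1 - e"
  have e: "0 < e" "e \<le> 1 / 4" using k by (auto simp: e_def field_simps)
  have c: "0 < c" "c < 1" using e by (auto simp: c_def)
  obtain C where C: "C \<ge> 0"
    "\<And>n. n \<ge> 1 \<Longrightarrow> exp (- real n * normal_density 0 1 (diag_level c n + 1)) \<le> C * real n powr (- (real k - 3 / 2))"
    using diag_level_decay[OF c] by blast
  let ?D = "(1 / sqrt (1 - c)) ^ k\<^sup>2"
  have ex: "real k - c\<^sup>2 * (2 * real k - 1) \<le> 3 / 2 - real k"
  proof -
    have "(1 - 2 * e) * (2 * real k - 1) \<le> c\<^sup>2 * (2 * real k - 1)"
      using k by (intro mult_right_mono) (auto simp: c_def power2_eq_square algebra_simps)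
    moreover have "(1 - 2 * e) * (2 * real k - 1) = 2 * real k - 1 - 1 / 2"
      using k by (simp add: e_def field_simps)
    ultimately show ?thesis by linarith
  qed
  show thesis
  proof (rule that[of "C + ?D"])
    fix n :: nat and M :: "'a measure" and Q
    assume n: "n \<ge> 1" and G: "GOE n M Q"
    interpret prob_space M using G by (simp add: GOE_def)
    let ?v = "diag_level c n"
    let ?E = "{\<omega> \<in> space M. \<forall>i<n. - ?v < Q \<omega> i i}"
      and ?H = "{\<omega> \<in> space M. heavy_block n k ((2 * real k - 1) * ?v\<^sup>2) (Q \<omega>)}"
    have v: "0 \<le> ?v" using c n by simp
    have ms: "?E \<in> sets M" "?H \<in> sets M"
      by (rule GOE_min_diagonal_tail(1)[OF G n v], rule GOE_heavy_block_measurable[OF G])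
    have "{\<omega> \<in> space M. kappa n (Q \<omega>) = k} \<subseteq> ?E \<union> ?H"
    proof
      fix \<omega> assume w: "\<omega> \<in> {\<omega> \<in> space M. kappa n (Q \<omega>) = k}"
      then obtain x where x: "is_global_minimizer n (Q \<omega>) x" "card {i. i < n \<and> 0 < x i} = k"
        using kappa_pos_minimizer k by blast
      have sym: "\<forall>i<n. \<forall>j<n. Q \<omega> i j = Q \<omega> j i"
        using G w by (auto simp: GOE_def)
      show "\<omega> \<in> ?E \<union> ?H"
        using support_is_heavy_block[OF sym x v] w by (force simp: not_less)
    qed
    then have "prob {\<omega> \<in> space M. kappa n (Q \<omega>) = k} \<le> prob (?E \<union> ?H)"
      by (rule finite_measure_mono) (intro sets.Un ms)
    also have "\<dots> \<le> prob ?E + prob ?H" using ms by (intro measure_Un_le)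
    also have "\<dots> \<le> C * real n powr (3 / 2 - real k) + ?D * real n powr (3 / 2 - real k)"
      using order_trans[OF GOE_min_diagonal_tail(2)[OF G n v] C(2)[OF n]]
        GOE_heavy_block_poly[OF G n _ c(2) ex] c by (intro add_mono) auto
    finally show "prob {\<omega> \<in> space M. kappa n (Q \<omega>) = k} \<le> (C + ?D) * real n powr (3 / 2 - real k)"
      by (simp add: distrib_right)
  qed (use C c in auto)
qed

text \<open>
  The level parameter is \<open>c = 19 / 20\<close>, and sampling costs another factor \<open>(19 / 20)\<^sup>2\<close>. The resulting exponent
  \<open>k - 2 * (19 / 20) ^ 4 * k\<^sup>2 / (k + 1)\<close> is at most \<open>- 3 / 2\<close> from \<open>k = 5\<close> on, since \<open>2 * (19 / 20) ^ 4 > 8 / 5\<close>.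
\<close>

lemma large_support_probability:
  obtains C where "C \<ge> 0"
    "\<And>n (M :: 'a measure) Q. n \<ge> 1 \<Longrightarrow> GOE n M Q \<Longrightarrow>
       measure M {\<omega> \<in> space M. kappa n (Q \<omega>) \<ge> 5} \<le> C * real n powr (- (3 / 2))"
proof -
  define c :: real where "c = 19 / 20"
  have c: "0 < c" "c < 1" by (auto simp: c_def)
  obtain C where C: "C \<ge> 0"
    "\<And>n. n \<ge> 1 \<Longrightarrow> exp (- real n * normal_density 0 1 (diag_level c n + 1)) \<le> C * real n powr (- (3 / 2))"
    using diag_level_decay[OF c] by blast
  let ?D = "\<lambda>k. (1 / sqrt (1 - c)) ^ k\<^sup>2"
  let ?a = "\<lambda>k. 2 * (real k)\<^sup>2 / (real k + 1) * (19 / 20)\<^sup>2"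
  have ex: "real k - c\<^sup>2 * ?a k \<le> - (3 / 2)" if "k \<ge> 5" for k
  proof -
    have "0 \<le> (real k - 5) * (6 * real k + 5)" using that by (intro mult_nonneg_nonneg) auto
    also have "\<dots> = 6 * (real k)\<^sup>2 - 25 * real k - 25"
      by (simp add: power2_eq_square algebra_simps)
    finally have le: "(real k)\<^sup>2 + 5 / 2 * real k + 3 / 2 \<le> 8 / 5 * (real k)\<^sup>2" by linarith
    have "(real k + 3 / 2) * (real k + 1) = (real k)\<^sup>2 + 5 / 2 * real k + 3 / 2"
      by (simp add: power2_eq_square field_simps)
    also note le
    also have "8 / 5 * (real k)\<^sup>2 \<le> c\<^sup>2 * (2 * (real k)\<^sup>2 * (19 / 20)\<^sup>2)" by (simp add: c_def power2_eq_square)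
    finally have "real k + 3 / 2 \<le> c\<^sup>2 * (2 * (real k)\<^sup>2 * (19 / 20)\<^sup>2) / (real k + 1)"
      by (simp add: pos_le_divide_eq)
    then show ?thesis by simp
  qed
  have ex1: "real 1 - c\<^sup>2 * 4 \<le> - (3 / 2)" by (simp add: c_def power2_eq_square)
  show thesis
  proof (rule that[of "C + (?D 1 + (\<Sum>k\<in>{5..66}. ?D k))"])
    fix n :: nat and M :: "'a measure" and Q
    assume n: "n \<ge> 1" and G: "GOE n M Q"
    interpret prob_space M using G by (simp add: GOE_def)
    let ?v = "diag_level c n" and ?r = "real n powr (- (3 / 2))"
    let ?E = "{\<omega> \<in> space M. \<forall>i<n. - ?v < Q \<omega> i i}"
      and ?H = "\<lambda>k a. {\<omega> \<in> space M. heavy_block n k (a * ?v\<^sup>2) (Q \<omega>)}"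
    have v: "0 \<le> ?v" using c n by simp
    have msE: "?E \<in> sets M" by (rule GOE_min_diagonal_tail(1)[OF G n v])
    have msH: "?H k a \<in> sets M" for k a
      by (rule GOE_heavy_block_measurable[OF G])
    have "{\<omega> \<in> space M. kappa n (Q \<omega>) \<ge> 5} \<subseteq> ?E \<union> (?H 1 4 \<union> (\<Union>k\<in>{5..66}. ?H k (?a k)))"
    proof
      fix \<omega> assume w: "\<omega> \<in> {\<omega> \<in> space M. kappa n (Q \<omega>) \<ge> 5}"
      then obtain x where x: "is_global_minimizer n (Q \<omega>) x" "card {i. i < n \<and> 0 < x i} = kappa n (Q \<omega>)"
        using kappa_pos_minimizer[OF refl, of n "Q \<omega>"] by force
      then have x5: "card {i. i < n \<and> 0 < x i} \<ge> 5" using w by simp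
      have sym: "\<forall>i<n. \<forall>j<n. Q \<omega> i j = Q \<omega> j i"
        using G w by (auto simp: GOE_def)
      show "\<omega> \<in> ?E \<union> (?H 1 4 \<union> (\<Union>k\<in>{5..66}. ?H k (?a k)))"
      proof (cases "\<omega> \<in> ?E")
        case False
        then obtain i where "i < n" "Q \<omega> i i \<le> - ?v" using w by (force simp: not_less)
        from large_support_heavy_block[OF sym x(1) x5 v this] show ?thesis
          using w by blast
      qed simp
    qed
    then have "prob {\<omega> \<in> space M. kappa n (Q \<omega>) \<ge> 5} \<le> prob (?E \<union> (?H 1 4 \<union> (\<Union>k\<in>{5..66}. ?H k (?a k))))"
      by (rule finite_measure_mono) (intro sets.Un sets.finite_UN msE msH finite_atLeastAtMost)
    also have "\<dots> \<le> prob ?E + prob (?H 1 4 \<union> (\<Union>k\<in>{5..66}. ?H k (?a k)))"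
      by (intro measure_Un_le sets.Un sets.finite_UN msE msH finite_atLeastAtMost)
    also have "\<dots> \<le> prob ?E + (prob (?H 1 4) + prob (\<Union>k\<in>{5..66}. ?H k (?a k)))"
      by (intro add_left_mono measure_Un_le sets.finite_UN msH finite_atLeastAtMost)
    also have "\<dots> \<le> prob ?E + (prob (?H 1 4) + (\<Sum>k\<in>{5..66}. prob (?H k (?a k))))"
      by (intro add_left_mono finite_measure_subadditive_finite image_subsetI msH finite_atLeastAtMost)
    also have "\<dots> \<le> C * ?r + (?D 1 * ?r + (\<Sum>k\<in>{5..66}. ?D k * ?r))"
    proof (intro add_mono sum_mono)
      show "prob ?E \<le> C * ?r"
        using order_trans[OF GOE_min_diagonal_tail(2)[OF G n v] C(2)[OF n]] .
      show "prob (?H 1 4) \<le> ?D 1 * ?r"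
        using c by (intro GOE_heavy_block_poly[OF G n _ c(2) ex1]) auto
      fix k :: nat assume "k \<in> {5..66}"
      then show "prob (?H k (?a k)) \<le> ?D k * ?r"
        using c by (intro GOE_heavy_block_poly[OF G n _ c(2) ex]) auto
    qed
    finally show "prob {\<omega> \<in> space M. kappa n (Q \<omega>) \<ge> 5} \<le> (C + (?D 1 + (\<Sum>k\<in>{5..66}. ?D k))) * ?r"
      by (simp only: distrib_right sum_distrib_right)
  qed (use C c in \<open>auto intro!: add_nonneg_nonneg sum_nonneg\<close>)
qed

lemma kappa_eq_probability_zero:
  assumes "n < k"
  shows "measure M {\<omega> \<in> space M. kappa n (Q \<omega>) = k} = 0"
    and "measure M {\<omega> \<in> space M. kappa n (Q \<omega>) \<ge> k} = 0"
proof -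
  have "kappa n (Q \<omega>) < k" for \<omega> using kappa_le[of n "Q \<omega>"] assms by linarith
  then have "{\<omega> \<in> space M. kappa n (Q \<omega>) = k} = {}" "{\<omega> \<in> space M. kappa n (Q \<omega>) \<ge> k} = {}"
    by (auto simp: not_le[symmetric])
  then show "measure M {\<omega> \<in> space M. kappa n (Q \<omega>) = k} = 0"
    "measure M {\<omega> \<in> space M. kappa n (Q \<omega>) \<ge> k} = 0" by (simp_all only: measure_empty)
qed

lemma ln_powr_ge_1:
  assumes "n \<ge> 3" "p \<ge> 0"
  shows "1 \<le> ln (real n) powr p"
proof -
  have "exp 1 \<le> real n" using e_less_272 assms(1) by linarith
  then have "1 \<le> ln (real n)" using assms(1) by (subst ln_ge_iff) auto
  then show ?thesis using assms(2) by (rule ge_one_powr_ge_zero)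
qed

text \<open>
  The sizes \<open>3\<close> and \<open>4\<close> are treated one by one, all others together. The logarithmic factor is at least one for \<open>n \<ge> 3\<close>,
  and for \<open>n < 3\<close> the event is empty, which matters at \<open>n = 1\<close>, where the right-hand side vanishes.
\<close>

lemma kappa_at_least_three_probability:
  obtains C where "C > 0"
    "\<And>n (M :: 'a measure) Q. n \<ge> 1 \<Longrightarrow> GOE n M Q \<Longrightarrow>
       measure M {\<omega> \<in> space M. kappa n (Q \<omega>) \<ge> 3} \<le> C * (ln (real n) powr (7 / 4) / real n powr (3 / 2))"
proof -
  obtain C3 where C3: "C3 \<ge> 0" "\<And>n (M :: 'a measure) Q. n \<ge> 1 \<Longrightarrow> GOE n M Q \<Longrightarrow>
       measure M {\<omega> \<in> space M. kappa n (Q \<omega>) = 3} \<le> C3 * real n powr (3 / 2 - real 3)"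
    by (rule support_size_probability[of 3]) auto
  obtain C4 where C4: "C4 \<ge> 0" "\<And>n (M :: 'a measure) Q. n \<ge> 1 \<Longrightarrow> GOE n M Q \<Longrightarrow>
       measure M {\<omega> \<in> space M. kappa n (Q \<omega>) = 4} \<le> C4 * real n powr (3 / 2 - real 4)"
    by (rule support_size_probability[of 4]) auto
  obtain C5 where C5: "C5 \<ge> 0" "\<And>n (M :: 'a measure) Q. n \<ge> 1 \<Longrightarrow> GOE n M Q \<Longrightarrow>
       measure M {\<omega> \<in> space M. kappa n (Q \<omega>) \<ge> 5} \<le> C5 * real n powr (- (3 / 2))"
    by (rule large_support_probability) auto
  show thesis
  proof (rule that[of "C3 + C4 + C5 + 1"])
    fix n :: nat and M :: "'a measure" and Q
    assume n: "n \<ge> 1" and G: "GOE n M Q"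
    interpret prob_space M using G by (simp add: GOE_def)
    let ?K = "\<lambda>P. {\<omega> \<in> space M. P (kappa n (Q \<omega>))}"
    let ?r = "real n powr (- (3 / 2))"
    show "prob (?K (\<lambda>k. k \<ge> 3)) \<le> (C3 + C4 + C5 + 1) * (ln (real n) powr (7 / 4) / real n powr (3 / 2))"
    proof (cases "n < 3")
      case True
      then show ?thesis using kappa_eq_probability_zero(2)[OF True, of M Q] C3 C4 C5 by simp
    next
      case False
      have ms: "?K P \<in> sets M" for P
        using measurable_sets[OF GOE_kappa_measurable[OF n G], of "{k. P k}"]
        by (simp add: vimage_def Int_def conj_commute)
      have "?K (\<lambda>k. k \<ge> 3) = ?K (\<lambda>k. k = 3) \<union> (?K (\<lambda>k. k = 4) \<union> ?K (\<lambda>k. k \<ge> 5))" by auto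
      then have "prob (?K (\<lambda>k. k \<ge> 3)) = prob (?K (\<lambda>k. k = 3) \<union> (?K (\<lambda>k. k = 4) \<union> ?K (\<lambda>k. k \<ge> 5)))" by simp
      also have "\<dots> \<le> prob (?K (\<lambda>k. k = 3)) + prob (?K (\<lambda>k. k = 4) \<union> ?K (\<lambda>k. k \<ge> 5))"
        by (intro measure_Un_le sets.Un ms)
      also have "\<dots> \<le> prob (?K (\<lambda>k. k = 3)) + (prob (?K (\<lambda>k. k = 4)) + prob (?K (\<lambda>k. k \<ge> 5)))"
        by (intro add_left_mono measure_Un_le ms)
      also have "\<dots> \<le> C3 * ?r + (C4 * ?r + C5 * ?r)"
      proof (intro add_mono)
        show "prob (?K (\<lambda>k. k = 3)) \<le> C3 * ?r" using C3(2)[OF n G] by simp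
        have "prob (?K (\<lambda>k. k = 4)) \<le> C4 * real n powr (- (5 / 2))" using C4(2)[OF n G] by simp
        also have "\<dots> \<le> C4 * ?r" using n C4(1) by (intro mult_left_mono powr_mono) auto
        finally show "prob (?K (\<lambda>k. k = 4)) \<le> C4 * ?r" .
        show "prob (?K (\<lambda>k. k \<ge> 5)) \<le> C5 * ?r" by (rule C5(2)[OF n G])
      qed
      also have "\<dots> \<le> (C3 + C4 + C5 + 1) * ?r" by (simp add: distrib_right)
      also have "\<dots> \<le> (C3 + C4 + C5 + 1) * (ln (real n) powr (7 / 4) * ?r)"
      proof (intro mult_left_mono)
        have "1 * ?r \<le> ln (real n) powr (7 / 4) * ?r"
          using False by (intro mult_right_mono ln_powr_ge_1) auto
        then show "?r \<le> ln (real n) powr (7 / 4) * ?r" by simp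
      qed (use C3 C4 C5 in simp)
      also have "ln (real n) powr (7 / 4) * ?r = ln (real n) powr (7 / 4) / real n powr (3 / 2)"
        by (simp only: powr_minus divide_inverse)
      finally show ?thesis .
    qed
  qed (use C3 C4 C5 in simp)
qed

theorem theorem9p3:
  shows
    "(\<forall>n\<ge>1. \<forall>(M :: 'a measure) Q. GOE n M Q \<longrightarrow>
        (AE \<omega> in M. \<exists>!x. is_global_minimizer n (Q \<omega>) x) \<and>
        (\<lambda>\<omega>. kappa n (Q \<omega>)) \<in> measurable M (count_space UNIV)) \<and>
     (\<forall>k\<ge>3. \<exists>C::real. \<forall>n\<ge>1. \<forall>(M :: 'a measure) Q. GOE n M Q \<longrightarrow>
        measure M {\<omega> \<in> space M. kappa n (Q \<omega>) = k}
          \<le> C * real n powr (2 - real k - 2 / (real k + 1))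
              * ln (real n) powr (real k - 3 / 2 + 1 / (real k + 1))) \<and>
     (\<exists>C>0. \<forall>n\<ge>1. \<forall>(M :: 'a measure) Q. GOE n M Q \<longrightarrow>
        measure M {\<omega> \<in> space M. kappa n (Q \<omega>) = 3}
          \<le> C * (ln (real n) powr (7 / 4) / real n powr (3 / 2))) \<and>
     (\<exists>C>0.
        (\<forall>n\<ge>1. \<forall>(M :: 'a measure) Q. GOE n M Q \<longrightarrow>
           measure M {\<omega> \<in> space M. kappa n (Q \<omega>) \<ge> 3}
             \<le> C * (ln (real n) powr (7 / 4) / real n powr (3 / 2))) \<and>
        (\<lambda>n. C * (ln (real n) powr (7 / 4) / real n powr (3 / 2)))
          \<in> o(\<lambda>n. 1 / (real n * ln (real n) powr (3 / 2))))"
proof -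
  have fixed: "\<exists>C::real. \<forall>n\<ge>1. \<forall>(M :: 'a measure) Q. GOE n M Q \<longrightarrow>
        measure M {\<omega> \<in> space M. kappa n (Q \<omega>) = k}
          \<le> C * real n powr (2 - real k - 2 / (real k + 1))
              * ln (real n) powr (real k - 3 / 2 + 1 / (real k + 1))" if k: "k \<ge> 3" for k
  proof -
    obtain C where C: "C \<ge> 0" "\<And>n (M :: 'a measure) Q. n \<ge> 1 \<Longrightarrow> GOE n M Q \<Longrightarrow>
       measure M {\<omega> \<in> space M. kappa n (Q \<omega>) = k} \<le> C * real n powr (3 / 2 - real k)"
      by (rule support_size_probability[of k]) (use k in auto)
    let ?p = "2 - real k - 2 / (real k + 1)" and ?l = "real k - 3 / 2 + 1 / (real k + 1)"
    show ?thesis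
    proof (intro exI[of _ C] allI impI)
      fix n :: nat and M :: "'a measure" and Q
      assume n: "n \<ge> 1" and G: "GOE n M Q"
      show "measure M {\<omega> \<in> space M. kappa n (Q \<omega>) = k} \<le> C * real n powr ?p * ln (real n) powr ?l"
      proof (cases "n < k")
        case True
        then show ?thesis using kappa_eq_probability_zero(1)[OF True, of M Q] C(1) by simp
      next
        case False
        \<comment> \<open>This is where \<open>k \<ge> 3\<close> enters: it makes \<open>3 / 2 - k\<close> at most the exponent that is claimed.\<close>
        have "2 / (real k + 1) \<le> 1 / 2" using k by (simp add: field_simps)
        then have "C * real n powr (3 / 2 - real k) \<le> C * real n powr ?p"
          using C(1) n by (intro mult_left_mono powr_mono) auto
        also have "\<dots> * 1 \<le> \<dots> * ln (real n) powr ?l"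
          using False k C(1) by (intro mult_left_mono ln_powr_ge_1) auto
        finally show ?thesis using C(2)[OF n G] by simp
      qed
    qed
  qed
  obtain C where C: "C > 0"
    "\<And>n (M :: 'a measure) Q. n \<ge> 1 \<Longrightarrow> GOE n M Q \<Longrightarrow>
       measure M {\<omega> \<in> space M. kappa n (Q \<omega>) \<ge> 3} \<le> C * (ln (real n) powr (7 / 4) / real n powr (3 / 2))"
    by (rule kappa_at_least_three_probability) auto
  have three: "measure M {\<omega> \<in> space M. kappa n (Q \<omega>) = 3} \<le> C * (ln (real n) powr (7 / 4) / real n powr (3 / 2))"
    if n: "n \<ge> 1" and G: "GOE n M Q" for n and M :: "'a measure" and Q
  proof -
    interpret prob_space M using G by (simp add: GOE_def)
    have "{\<omega> \<in> space M. kappa n (Q \<omega>) \<ge> 3} \<in> sets M"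
      using measurable_sets[OF GOE_kappa_measurable[OF n G], of "{3..}"]
      by (simp add: vimage_def Int_def conj_commute)
    then have "prob {\<omega> \<in> space M. kappa n (Q \<omega>) = 3} \<le> prob {\<omega> \<in> space M. kappa n (Q \<omega>) \<ge> 3}"
      by (intro finite_measure_mono) auto
    then show ?thesis using C(2)[OF n G] by linarith
  qed
  have little_o: "(\<lambda>n. C * (ln (real n) powr (7 / 4) / real n powr (3 / 2)))
          \<in> o(\<lambda>n. 1 / (real n * ln (real n) powr (3 / 2)))"
    using C(1) by real_asymp
  show ?thesis
  proof (intro conjI)
    show "\<forall>n\<ge>1. \<forall>(M :: 'a measure) Q. GOE n M Q \<longrightarrow>
        (AE \<omega> in M. \<exists>!x. is_global_minimizer n (Q \<omega>) x) \<and>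
        (\<lambda>\<omega>. kappa n (Q \<omega>)) \<in> measurable M (count_space UNIV)"
      by (intro allI impI conjI GOE_unique_minimizer GOE_kappa_measurable)
    show "\<forall>k\<ge>3. \<exists>C::real. \<forall>n\<ge>1. \<forall>(M :: 'a measure) Q. GOE n M Q \<longrightarrow>
        measure M {\<omega> \<in> space M. kappa n (Q \<omega>) = k}
          \<le> C * real n powr (2 - real k - 2 / (real k + 1))
              * ln (real n) powr (real k - 3 / 2 + 1 / (real k + 1))"
      by (intro allI impI fixed)
  qed (intro exI[of _ C] conjI allI impI C three little_o; assumption)+
qed

end
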